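(* Suppose $\rho \in (0,\infty]$, $m \geq 1$ is an integer, and $F : I^m \to \mathbb{R}$, where $I = [0,\rho)$. The following are equivalent. (1) $F[-]$ preserves positivity on the space of $m$-tuples of positive Hankel matrices with entries in $I$. (2) $F$ is absolutely monotonic on $I^m$. (3) $F[-]$ preserves positivity on the space of $m$-tuples of all positive matrices with entries in $I$.
   Context: "Positive" for a matrix means (real symmetric) positive semidefinite; the matrices in an $m$-tuple are all $N \times N$ for a common $N$, and all dimensions $N \geq 1$ are considered. $F$ acts entrywise on $m$-tuples of $N \times N$ matrices with entries in $I$: $F[A_1,\dots,A_m]_{ij} := F(a_{1,ij},\dots,a_{m,ij})$; "preserves positivity" on a set of $m$-tuples means $F[A_1,\dots,A_m]$ is positive for every tuple in the set. $F$ is absolutely monotonic on $I^m$ if it is continuous on $I^m$ and, at every interior point of $I^m$ and for all multi-indices $\alpha \in \mathbb{Z}_+^m$ ($\mathbb{Z}_+ = \{0,1,2,\dots\}$), the mixed partial derivative $D^\alpha F$ exists and is non-negative. *)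

theory Defs
  imports "HOL-Analysis.Analysis" "Jordan_Normal_Form.Matrix"
begin

text \<open>
  Vectors in the sense of \<^typ>\<open>real ^ 'm\<close> carry the \<open>m\<close> arguments of \<open>F\<close>, so that \<open>m = CARD('m)\<close>;
  the \<open>N \<times> N\<close> matrices, whose size varies inside the statement, are of type \<^typ>\<open>real mat\<close>, and
  an \<open>m\<close>-tuple of matrices is a function \<^typ>\<open>'m \<Rightarrow> real mat\<close>.
\<close>

definition dom_I :: "ereal \<Rightarrow> real set" where
  "dom_I \<rho> = {t. 0 \<le> t \<and> ereal t < \<rho>}"

definition cube :: "real set \<Rightarrow> (real ^ 'm) set" where
  "cube I = {x. \<forall>k. vec_nth x k \<in> I}"

definition positive_mat :: "real mat \<Rightarrow> bool" where
  "positive_mat A \<longleftrightarrow> square_mat A \<and> transpose_mat A = A \<and>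
     (\<forall>v \<in> carrier_vec (dim_row A). 0 \<le> scalar_prod v (A *\<^sub>v v))"

definition hankel_mat :: "real mat \<Rightarrow> bool" where
  "hankel_mat A \<longleftrightarrow> square_mat A \<and>
     (\<exists>s :: nat \<Rightarrow> real. \<forall>i < dim_row A. \<forall>j < dim_col A. A $$ (i, j) = s (i + j))"

definition positive_mats :: "real set \<Rightarrow> real mat set" where
  "positive_mats I =
     {A. positive_mat A \<and> (\<forall>i < dim_row A. \<forall>j < dim_col A. A $$ (i, j) \<in> I)}"

definition positive_hankel_mats :: "real set \<Rightarrow> real mat set" where
  "positive_hankel_mats I = {A \<in> positive_mats I. hankel_mat A}"

definition entrywise :: "nat \<Rightarrow> (real ^ 'm \<Rightarrow> real) \<Rightarrow> ('m \<Rightarrow> real mat) \<Rightarrow> real mat" where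
  "entrywise N F A = Matrix.mat N N (\<lambda>(i, j). F (\<chi> k. A k $$ (i, j)))"

definition preserves_positivity :: "(real ^ 'm \<Rightarrow> real) \<Rightarrow> real mat set \<Rightarrow> bool" where
  "preserves_positivity F S \<longleftrightarrow>
     (\<forall>N \<ge> 1. \<forall>A. (\<forall>k. A k \<in> S \<inter> carrier_mat N N) \<longrightarrow> positive_mat (entrywise N F A))"

text \<open>
  Iterated partial derivatives: \<open>iter_partial [k\<^sub>1, \<dots>, k\<^sub>r] F\<close> is
  \<open>\<partial>\<^bsub>k\<^sub>1\<^esub> \<cdots> \<partial>\<^bsub>k\<^sub>r\<^esub> F\<close>. Since \<^const>\<open>deriv\<close> is total, existence is a separate predicate.
\<close>

primrec iter_partial :: "'m list \<Rightarrow> (real ^ 'm \<Rightarrow> real) \<Rightarrow> real ^ 'm \<Rightarrow> real" where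
  "iter_partial [] F = F"
| "iter_partial (k # ks) F =
     (\<lambda>x. deriv (\<lambda>t. iter_partial ks F (x + t *\<^sub>R axis k 1)) 0)"

primrec iter_partial_exists :: "'m list \<Rightarrow> (real ^ 'm \<Rightarrow> real) \<Rightarrow> real ^ 'm \<Rightarrow> bool" where
  "iter_partial_exists [] F x \<longleftrightarrow> True"
| "iter_partial_exists (k # ks) F x \<longleftrightarrow>
     (\<forall>\<^sub>F y in nhds x. iter_partial_exists ks F y) \<and>
     (\<lambda>t. iter_partial ks F (x + t *\<^sub>R axis k 1)) field_differentiable (at 0)"

text \<open>
  The index type carries no order, so a multi-index \<open>\<alpha>\<close> does not single out one order of
  differentiation. \<open>orders \<alpha>\<close> is the set of all of them (coordinate \<open>k\<close> occurs \<open>\<alpha> k\<close> times), and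
  \<open>D\<^sup>\<alpha> F\<close> is required to exist and be non-negative for each.
\<close>

definition orders :: "('m \<Rightarrow> nat) \<Rightarrow> 'm list set" where
  "orders \<alpha> = {ks. \<forall>k. count_list ks k = \<alpha> k}"

definition absolutely_monotonic_on :: "(real ^ 'm) set \<Rightarrow> (real ^ 'm \<Rightarrow> real) \<Rightarrow> bool" where
  "absolutely_monotonic_on S F \<longleftrightarrow>
     continuous_on S F \<and>
     (\<forall>x \<in> interior S. \<forall>\<alpha>. \<forall>ks \<in> orders \<alpha>.
        iter_partial_exists ks F x \<and> 0 \<le> iter_partial ks F x)"

end

theory Submission
  imports Defs "HOL-Computational_Algebra.Polynomial"
begin

text \<open>
  Forward differences mediate between the three conditions. The pivot is a fourth condition:
  \<open>F\<close> is continuous on the cube and all its mixed forward differences along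
  coordinate axes, with non-negative steps, are non-negative.

  From the fourth condition to preservation of positivity. In one coordinate, the Bernstein
  polynomials of \<open>F\<close> in their Newton form are \<open>\<Sum>\<^sub>j (n choose j)
  t\<^sup>j (\<Delta>\<^sup>jF)(\<dots>, 0, \<dots>)\<close>, with step \<open>r/n\<close>.
  Their coefficients are again functions with non-negative mixed differences, of one coordinate
  less. By induction on the coordinates, \<open>F[A\<^sub>1, \<dots>, A\<^sub>m]\<close> is a
  limit of sums of entrywise products of positive semidefinite matrices, and the Schur product
  theorem applies (\<open>psd_of_differences_nonneg\<close>).

  Between the fourth condition and absolute monotonicity. Partial derivatives with a sign give
  differences with the same sign by the mean value theorem, and continuity carries this to the
  boundary of the cube. Conversely, if the differences of orders one, two and three are
  non-negative along a line, then the slopes increase and the second difference is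
  \<open>O(h\<^sup>2)\<close>, so the one-sided slopes have a common limit
  (\<open>differentiable_of_differences\<close>); the derivative inherits the fourth condition's
  sign property as a limit of difference quotients, and the argument repeats.

  From positive Hankel matrices to the fourth condition. Matrices of sizes one, two and three
  show that \<open>F\<close> is non-negative, monotone and continuous. For the mixed
  differences, let \<open>u\<^sub>1, \<dots>, u\<^sub>n \<ge> 0\<close> be vectors,
  \<open>q\<^sub>1, \<dots>, q\<^sub>n\<close> positive integers, and take the Hankel matrices
  with entries \<open>y + \<Sum>\<^sub>l q\<^sub>l\<^bsup>i+j\<^esup> u\<^sub>l\<close>. For a
  polynomial \<open>p\<close> with coefficients \<open>c\<^sub>i\<close>, positivity says
  \<open>\<Sum>\<^sub>i\<^sub>j c\<^sub>i c\<^sub>j F(y + \<Sum>\<^sub>l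
  q\<^sub>l\<^bsup>i+j\<^esup> u\<^sub>l) \<ge> 0\<close>. If \<open>F\<close> were smooth, a
  Taylor expansion would turn a monomial \<open>\<delta>\<close> in the \<open>u\<^sub>l\<close>
  into a multiple of \<open>p(\<Prod>\<^sub>l
  q\<^sub>l\<^bsup>\<delta>\<^sub>l\<^esup>)\<^sup>2\<close>. So choose the
  \<open>q\<^sub>l\<close> such that these products are distinct and let \<open>p\<close> vanish
  at all those of degree at most \<open>n\<close> except the one of \<open>u\<^sub>1 \<cdots>
  u\<^sub>n\<close>: the leading term is then a positive multiple of the mixed derivative along
  \<open>u\<^sub>1, \<dots>, u\<^sub>n\<close>. This is the argument of Horn and Loewner. As
  \<open>F\<close> is only continuous, it is carried out for an average of \<open>F\<close> over
  many lattice translates. For such an average the Newton expansion is exact, and a difference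
  of order \<open>j\<close> with the fine step is \<open>L\<^bsup>-j\<^esup>\<close> times a
  bounded difference with a step \<open>L\<close> times larger, which makes all terms of degree
  above \<open>n\<close> negligible as \<open>L \<rightarrow> \<infinity>\<close>
  (\<open>smoothed_mixed_diff_lower_bound\<close>). Continuity then removes the averaging
  (\<open>mixed_diff_nonneg_of_hankel_positive\<close>).
\<close>

section \<open>Forward differences\<close>

definition fwd_diff :: "'a::ab_semigroup_add \<Rightarrow> ('a \<Rightarrow> real) \<Rightarrow> 'a \<Rightarrow> real" where
  "fwd_diff v f x = f (x + v) - f x"

primrec mixed_diff :: "'a::ab_semigroup_add list \<Rightarrow> ('a \<Rightarrow> real) \<Rightarrow> 'a \<Rightarrow> real" where
  "mixed_diff [] f = f"
| "mixed_diff (v # vs) f = fwd_diff v (mixed_diff vs f)"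

lemma funpow_fwd_diff_Suc:
  "(fwd_diff v ^^ Suc n) f x = (fwd_diff v ^^ n) f (x + v) - (fwd_diff v ^^ n) f x"
  by (simp only: funpow.simps(2) comp_apply fwd_diff_def[of v "(fwd_diff v ^^ n) f" x])

lemma fwd_diff_commute: "fwd_diff u (fwd_diff v f) = fwd_diff v (fwd_diff u f)"
  by (rule ext) (simp add: fwd_diff_def add.assoc add.commute[of u v])

lemma mixed_diff_fwd_diff: "mixed_diff vs (fwd_diff u f) = fwd_diff u (mixed_diff vs f)"
  by (induction vs) (simp_all add: fwd_diff_commute)

lemma mixed_diff_append: "mixed_diff (us @ vs) f = mixed_diff us (mixed_diff vs f)"
  by (induction us) simp_all

lemma mixed_diff_replicate: "mixed_diff (replicate j v) f = (fwd_diff v ^^ j) f"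
  by (induction j) simp_all

lemma mixed_diff_diff: "mixed_diff vs (\<lambda>x. f x - g x) x = mixed_diff vs f x - mixed_diff vs g x"
  by (induction vs arbitrary: x) (simp_all add: fwd_diff_def)

text \<open>
  Newton's interpolation formula; it is the binomial expansion of the \<open>w\<close>-th power
  of the shift by \<open>v\<close>, which is the identity plus \<open>fwd_diff v\<close>.
\<close>
lemma newton_forward:
  fixes f :: "'a::real_vector \<Rightarrow> real"
  shows "f (x + real w *\<^sub>R v) = (\<Sum>j\<le>w. real (w choose j) * (fwd_diff v ^^ j) f x)"
proof (induction w arbitrary: f)
  case 0
  then show ?case by simp
next
  case (Suc w)
  let ?a = "\<lambda>j. (fwd_diff v ^^ j) f x"
  have "f (x + real (Suc w) *\<^sub>R v) = fwd_diff v f (x + real w *\<^sub>R v) + f (x + real w *\<^sub>R v)"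
    by (simp add: fwd_diff_def algebra_simps)
  also have "fwd_diff v f (x + real w *\<^sub>R v) = (\<Sum>j\<le>w. real (w choose j) * ?a (Suc j))"
    by (subst Suc) (simp add: funpow_swap1)
  also have "f (x + real w *\<^sub>R v) = (\<Sum>j\<le>w. real (w choose j) * ?a j)"
    by (rule Suc)
  also have "\<dots> = (\<Sum>j\<le>Suc w. real (w choose j) * ?a j)"
    by simp
  also have "\<dots> = ?a 0 + (\<Sum>j\<le>w. real (w choose Suc j) * ?a (Suc j))"
    by (subst sum.atMost_Suc_shift) simp
  finally have "f (x + real (Suc w) *\<^sub>R v) =
      ?a 0 + (\<Sum>j\<le>w. real (w choose j) * ?a (Suc j) + real (w choose Suc j) * ?a (Suc j))"
    by (simp add: sum.distrib)
  also have "\<dots> = (\<Sum>j\<le>Suc w. real (Suc w choose j) * ?a j)"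
    by (subst sum.atMost_Suc_shift) (simp add: algebra_simps)
  finally show ?case .
qed

lemma funpow_fwd_diff_line:
  fixes G :: "'a::real_vector \<Rightarrow> real"
  shows "(fwd_diff h ^^ n) (\<lambda>t. G (x + t *\<^sub>R e)) t = (fwd_diff (h *\<^sub>R e) ^^ n) G (x + t *\<^sub>R e)"
proof (induction n arbitrary: t)
  case (Suc n)
  show ?case unfolding funpow_fwd_diff_Suc Suc by (simp only: scaleR_add_left add.assoc)
qed simp

section \<open>Differentiability from the signs of differences\<close>

text \<open>
  Applied to the increments of a function over equal steps, this comparison of means is
  convexity at rational points.
\<close>
lemma sum_prefix_le_of_increasing:
  fixes d :: "nat \<Rightarrow> real"
  assumes inc: "\<And>i. Suc i < q \<Longrightarrow> d i \<le> d (Suc i)" and "p \<le> q"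
  shows "real q * (\<Sum>i<p. d i) \<le> real p * (\<Sum>i<q. d i)"
proof (cases "p = q")
  case False
  with \<open>p \<le> q\<close> have pq: "p < q" by simp
  have mono: "d i \<le> d j" if "i \<le> j" "j < q" for i j
    using that by (induction j rule: dec_induct) (auto intro: order_trans inc)
  have "(\<Sum>i<p. d i) \<le> (\<Sum>i<p. d p)"
    using pq by (intro sum_mono mono) auto
  hence 1: "(\<Sum>i<p. d i) \<le> real p * d p" by simp
  have "(\<Sum>i\<in>{p..<q}. d p) \<le> (\<Sum>i\<in>{p..<q}. d i)"
    using pq by (intro sum_mono mono) auto
  hence 2: "(real q - real p) * d p \<le> (\<Sum>i\<in>{p..<q}. d i)" using pq by (simp add: of_nat_diff)
  have split: "(\<Sum>i<q. d i) = (\<Sum>i<p. d i) + (\<Sum>i\<in>{p..<q}. d i)"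
    by (metis atLeast0LessThan pq less_imp_le_nat sum.atLeastLessThan_concat zero_le)
  have "(real q - real p) * (\<Sum>i<p. d i) \<le> (real q - real p) * (real p * d p)"
    using 1 pq by (intro mult_left_mono) auto
  also have "\<dots> = real p * ((real q - real p) * d p)" by simp
  also have "\<dots> \<le> real p * (\<Sum>i\<in>{p..<q}. d i)"
    using 2 by (intro mult_left_mono) auto
  finally show ?thesis unfolding split by (simp add: algebra_simps)
qed simp

text \<open>
  Non-negative second differences give monotone slopes at rational ratios \<open>p / q\<close>
  of the two steps; monotonicity of \<open>f\<close> extends this to real ratios, by rounding
  \<open>h\<close> up to a multiple of \<open>H / q\<close>.
\<close>
lemma slope_mono_of_differences:
  fixes f :: "real \<Rightarrow> real"
  assumes diffs: "\<And>n x h. n \<le> 2 \<Longrightarrow> a < x \<Longrightarrow> 0 \<le> h \<Longrightarrow> x + real n * h < b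
                     \<Longrightarrow> 0 \<le> (fwd_diff h ^^ n) f x"
    and x: "a < x" "0 < h" "h \<le> H" "x + H < b"
  shows "H * (f (x + h) - f x) \<le> h * (f (x + H) - f x)"
proof -
  have mono: "f y \<le> f z" if "a < y" "y \<le> z" "z < b" for y z
    using diffs[of 1 y "z - y"] that by (simp add: fwd_diff_def)
  have le: "f (x + h) - f x \<le> (h / H + 1 / real q) * (f (x + H) - f x)" if q: "q > 0" for q
  proof -
    define p where "p = nat \<lceil>h * real q / H\<rceil>"
    have pos: "0 \<le> h * real q / H" using x by simp
    have p1: "h * real q / H \<le> real p" unfolding p_def by linarith
    have p2: "real p \<le> h * real q / H + 1"
      unfolding p_def using pos by linarith
    have "h * real q / H \<le> real q"
      using x mult_left_mono[of h H "real q"] by (simp add: field_simps)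
    hence pq: "p \<le> q" unfolding p_def by linarith
    define \<eta> where "\<eta> = H / real q"
    have \<eta>: "\<eta> > 0" "real q * \<eta> = H" using x q by (auto simp: \<eta>_def)
    define d where "d i = f (x + real (Suc i) * \<eta>) - f (x + real i * \<eta>)" for i
    have "d i \<le> d (Suc i)" if "Suc i < q" for i
    proof -
      have "real (Suc (Suc i)) * \<eta> \<le> real q * \<eta>"
        using that \<eta> by (intro mult_right_mono) auto
      hence "x + real i * \<eta> + real 2 * \<eta> < b" using \<eta> x by (simp add: algebra_simps)
      moreover have "a < x + real i * \<eta>" using x \<eta> by (simp add: add_pos_nonneg less_le_trans)
      ultimately have "0 \<le> (fwd_diff \<eta> ^^ 2) f (x + real i * \<eta>)"
        using \<eta> by (intro diffs) auto
      thus ?thesis by (simp add: d_def numeral_2_eq_2 fwd_diff_def algebra_simps)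
    qed
    hence "real q * (\<Sum>i<p. d i) \<le> real p * (\<Sum>i<q. d i)"
      using pq by (rule sum_prefix_le_of_increasing)
    moreover have "(\<Sum>i<k. d i) = f (x + real k * \<eta>) - f x" for k
      by (induction k) (auto simp: d_def)
    ultimately have "real q * (f (x + real p * \<eta>) - f x) \<le> real p * (f (x + H) - f x)"
      using \<eta> by simp
    hence "f (x + real p * \<eta>) - f x \<le> (real p / real q) * (f (x + H) - f x)"
      using q by (simp add: field_simps)
    moreover have "f (x + h) \<le> f (x + real p * \<eta>)"
    proof (rule mono)
      have "h = (h * real q / H) * \<eta>" using x q by (simp add: \<eta>_def)
      also have "\<dots> \<le> real p * \<eta>" using p1 \<eta> by (intro mult_right_mono) auto
      finally show "x + h \<le> x + real p * \<eta>" by simp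
      have "real p * \<eta> \<le> real q * \<eta>" using pq \<eta> by (intro mult_right_mono) auto
      thus "x + real p * \<eta> < b" using x \<eta> by simp
    qed (use x in auto)
    moreover have "(real p / real q) * (f (x + H) - f x) \<le> (h / H + 1 / real q) * (f (x + H) - f x)"
    proof (rule mult_right_mono)
      show "real p / real q \<le> h / H + 1 / real q"
        using p2 q x by (simp add: field_simps)
      show "0 \<le> f (x + H) - f x" using mono[of x "x + H"] x by simp
    qed
    ultimately show ?thesis by linarith
  qed
  have "(\<lambda>q. (h / H + 1 / real q) * (f (x + H) - f x)) \<longlonglongrightarrow> (h / H + 0) * (f (x + H) - f x)"
    by (intro tendsto_intros lim_inverse_n')
  hence "f (x + h) - f x \<le> (h / H + 0) * (f (x + H) - f x)"
    by (rule tendsto_lowerbound) (use le in \<open>auto intro: eventually_sequentiallyI[of 1]\<close>)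
  thus ?thesis using x by (simp add: field_simps)
qed

text \<open>
  Two successive summations. As second differences increase, \<open>n\<close> times the first of
  them is at most the first difference reached after \<open>n\<close> steps; as first
  differences increase, \<open>n\<close> times that one is at most the growth of
  \<open>f\<close> over the following \<open>n\<close> steps.
\<close>
lemma second_diff_le_of_third_diff:
  fixes f :: "real \<Rightarrow> real"
  assumes diffs: "\<And>n x h. n \<le> 3 \<Longrightarrow> a < x \<Longrightarrow> 0 \<le> h \<Longrightarrow> x + real n * h < b
                     \<Longrightarrow> 0 \<le> (fwd_diff h ^^ n) f x"
    and z: "a < z" "0 \<le> h" "z + 2 * real n * h < b" "0 < n"
  shows "(real n)\<^sup>2 * (fwd_diff h ^^ 2) f z \<le> f (z + 2 * real n * h) - f z"
proof -
  have mono: "f y \<le> f w" if "a < y" "y \<le> w" "w < b" for y w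
    using diffs[of 1 y "w - y"] that by (simp add: fwd_diff_def)
  define d where "d i = f (z + real (Suc i) * h) - f (z + real i * h)" for i
  have reach: "z + real i * h + real j * h < b" if "i + j \<le> 2 * n" for i j
  proof -
    have "real (i + j) * h \<le> real (2 * n) * h" using that z by (intro mult_right_mono) auto
    thus ?thesis using z by (simp add: algebra_simps)
  qed
  have start: "a < z + real i * h" for i using z by (simp add: add_pos_nonneg less_le_trans)
  have d_inc: "d i \<le> d (Suc i)" if "i + 2 \<le> 2 * n" for i
    using diffs[of 2 "z + real i * h" h] reach[of i 2] start[of i] that z
    by (simp add: d_def numeral_2_eq_2 fwd_diff_def algebra_simps)
  have dd_inc: "d (Suc i) - d i \<le> d (Suc (Suc i)) - d (Suc i)" if "i + 3 \<le> 2 * n" for i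
    using diffs[of 3 "z + real i * h" h] reach[of i 3] start[of i] that z
    by (simp add: d_def numeral_3_eq_3 fwd_diff_def algebra_simps)
  have dd: "d 1 - d 0 \<le> d (Suc i) - d i" if "i + 2 \<le> 2 * n" for i
    using that
  proof (induction i)
    case (Suc i)
    from Suc.prems have "i + 3 \<le> 2 * n" by simp
    with Suc.IH dd_inc[of i] show ?case by simp
  qed simp
  have d0: "0 \<le> d 0" using mono[of z "z + h"] reach[of 0 1] z by (simp add: d_def)
  have "real i * (d 1 - d 0) \<le> d i" if "i \<le> n" for i
    using that
  proof (induction i)
    case (Suc i)
    thus ?case using dd[of i] z by (simp add: algebra_simps)
  qed (use d0 in simp)
  hence 1: "real n * (d 1 - d 0) \<le> d n" by simp
  have d_mono: "d n \<le> d (n + i)" if "i < n" for i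
    using that
  proof (induction i)
    case (Suc i)
    thus ?case using d_inc[of "n + i"] by simp
  qed simp
  have "(\<Sum>i<n. d n) \<le> (\<Sum>i<n. d (n + i))" by (intro sum_mono d_mono) auto
  also have "(\<Sum>i<k. d (n + i)) = f (z + real (n + k) * h) - f (z + real n * h)" for k
    by (induction k) (auto simp: d_def)
  finally have 2: "real n * d n \<le> f (z + 2 * real n * h) - f (z + real n * h)" by (simp add: mult.assoc)
  have 3: "f z \<le> f (z + real n * h)" using mono[of z "z + real n * h"] reach[of n 0] z by simp
  have "(real n)\<^sup>2 * (d 1 - d 0) = real n * (real n * (d 1 - d 0))" by (simp add: power2_eq_square)
  also have "\<dots> \<le> real n * d n" using 1 by (intro mult_left_mono) auto
  also have "\<dots> \<le> f (z + 2 * real n * h) - f z" using 2 3 by simp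
  finally show ?thesis by (simp add: d_def numeral_2_eq_2 fwd_diff_def algebra_simps)
qed

text \<open>
  With \<open>n\<close> of order \<open>1 / h\<close>, the preceding bound makes the second
  difference at step \<open>h\<close> of order \<open>h\<^sup>2\<close>. Hence the left and
  right slopes at step \<open>h\<close>, which are monotone in \<open>h\<close> and enclose the
  infimum \<open>R\<close> of the right slopes, differ by \<open>O(h)\<close>, and
  \<open>R\<close> is the derivative.
\<close>
lemma differentiable_of_differences:
  fixes f :: "real \<Rightarrow> real"
  assumes diffs: "\<And>n x h. n \<le> 3 \<Longrightarrow> a < x \<Longrightarrow> 0 \<le> h \<Longrightarrow> x + real n * h < b
                     \<Longrightarrow> 0 \<le> (fwd_diff h ^^ n) f x"
    and x: "a < x" "x < b"
  shows "f field_differentiable (at x)"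
proof -
  obtain r where r: "0 < r" "a < x - r" "x + r < b"
  proof
    show "0 < min (x - a) (b - x) / 2" "a < x - min (x - a) (b - x) / 2"
      "x + min (x - a) (b - x) / 2 < b" using x by (auto simp: min_def field_simps)
  qed
  define q where "q h = (f (x + h) - f x) / h" for h
  define C where "C = 16 * (f (x + r) - f (x - r)) / r\<^sup>2"
  have mono: "f y \<le> f w" if "a < y" "y \<le> w" "w < b" for y w
    using diffs[of 1 y "w - y"] that by (simp add: fwd_diff_def)
  have slope: "H * (f (y + h) - f y) \<le> h * (f (y + H) - f y)"
    if "a < y" "0 < h" "h \<le> H" "y + H < b" for y h H
    by (rule slope_mono_of_differences[of a b f y h H]) (use diffs that in auto)
  have right: "q h \<le> q H" if "0 < h" "h \<le> H" "H \<le> r" for h H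
    using slope[of x h H] that r x by (simp add: q_def field_simps)
  have left: "q (- H) \<le> q (- h)" if "0 < h" "h \<le> H" "H \<le> r" for h H
  proof (cases "h = H")
    case False
    with slope[of "x - H" "H - h" H] that r x show ?thesis by (simp add: q_def field_simps)
  qed simp
  have mid: "q (- h) \<le> q h" if "0 < h" "h \<le> r" for h
  proof -
    have "q h - q (- h) = (fwd_diff h ^^ 2) f (x - h) / h"
      using that by (simp add: q_def numeral_2_eq_2 fwd_diff_def field_simps)
    moreover have "0 \<le> (fwd_diff h ^^ 2) f (x - h)" using diffs[of 2 "x - h" h] that r by simp
    ultimately show ?thesis by (metis diff_ge_0_iff_ge divide_nonneg_pos that(1))
  qed
  have cross: "q (- h) \<le> q k" if "0 < h" "h \<le> r" "0 < k" "k \<le> r" for h k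
  proof -
    have "min h k \<le> r" using that by linarith
    thus ?thesis using left[of "min h k" h] mid[of "min h k"] right[of "min h k" k] that by simp
  qed
  have close: "q h - q (- h) \<le> C * h" if h: "0 < h" "h \<le> r / 4" for h
  proof -
    define n where "n = nat \<lfloor>r / (2 * h)\<rfloor>"
    have "2 \<le> r / (2 * h)" using h by (simp add: field_simps)
    hence n: "real n \<le> r / (2 * h)" "r / (2 * h) - 1 \<le> real n" "0 < n"
      unfolding n_def by linarith+
    \<comment> \<open>for \<open>h \<le> r / 4\<close>, rounding \<open>r / (2 h)\<close> down loses at most half of it\<close>
    have "1 \<le> r / (4 * h)" using h by (simp add: field_simps)
    hence n2: "r / (4 * h) \<le> real n" using n(2) by (simp add: field_simps)
    have nh0: "0 \<le> 2 * real n * h" using h by simp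
    have nh: "2 * real n * h \<le> r" using n(1) h by (simp add: field_simps)
    have "(r / (4 * h))\<^sup>2 * (fwd_diff h ^^ 2) f (x - h) \<le> (real n)\<^sup>2 * (fwd_diff h ^^ 2) f (x - h)"
      using n2 h r diffs[of 2 "x - h" h] by (intro mult_right_mono power_mono) auto
    also have "\<dots> \<le> f (x - h + 2 * real n * h) - f (x - h)"
      by (rule second_diff_le_of_third_diff[of a b]) (use diffs n h r nh in auto)
    also have "\<dots> \<le> f (x + r) - f (x - r)"
      using mono[of "x - h + 2 * real n * h" "x + r"] mono[of "x - r" "x - h"] nh nh0 r h by simp
    finally have "(fwd_diff h ^^ 2) f (x - h) \<le> C * h * h"
      using h r unfolding C_def by (simp add: field_simps power2_eq_square)
    moreover have "(fwd_diff h ^^ 2) f (x - h) = (q h - q (- h)) * h"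
      using h by (simp add: q_def numeral_2_eq_2 fwd_diff_def field_simps)
    ultimately show ?thesis using h by simp
  qed
  define R where "R = Inf (q ` {0<..r})"
  have ne: "q ` {0<..r} \<noteq> {}" using r by auto
  have lower: "q (- h) \<le> R" if "0 < h" "h \<le> r" for h
    unfolding R_def by (rule cInf_greatest[OF ne]) (use cross that in auto)
  have upper: "R \<le> q h" if "0 < h" "h \<le> r" for h
    unfolding R_def by (rule cInf_lower) (use that cross[of r] r in \<open>auto intro!: bdd_belowI[of _ "q (- r)"]\<close>)
  have est: "\<bar>q h - R\<bar> \<le> C * \<bar>h\<bar>" if "h \<noteq> 0" "\<bar>h\<bar> \<le> r / 4" for h
    using lower[of "\<bar>h\<bar>"] upper[of "\<bar>h\<bar>"] close[of "\<bar>h\<bar>"] that r by (cases "h > 0") auto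
  have "((\<lambda>h. q h - R) \<longlongrightarrow> 0) (at 0)"
  proof (rule Lim_null_comparison)
    show "\<forall>\<^sub>F h in at 0. norm (q h - R) \<le> C * \<bar>h\<bar>"
      unfolding eventually_at using r est
      by (intro exI[of _ "r / 4"]) (auto simp: dist_real_def)
    show "((\<lambda>h. C * \<bar>h\<bar>) \<longlongrightarrow> 0) (at 0)"
      by (rule tendsto_eq_intros refl | simp)+
  qed
  hence "(q \<longlongrightarrow> R) (at 0)" by (simp add: LIM_zero_iff)
  hence "(f has_field_derivative R) (at x)"
    unfolding DERIV_def q_def .
  thus ?thesis by (auto simp: field_differentiable_def)
qed

section \<open>A Hankel form that isolates one monomial\<close>

lemma binomial_as_polynomial:
  "\<exists>e :: nat \<Rightarrow> real. \<forall>w. real (w choose j) = (\<Sum>i\<le>j. e i * real w ^ i)"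
proof (induction j)
  case 0
  show ?case by (rule exI[of _ "\<lambda>_. 1"]) simp
next
  case (Suc j)
  then obtain e where e: "\<And>w. real (w choose j) = (\<Sum>i\<le>j. e i * real w ^ i)" by blast
  define e' where "e' i = ((if i = 0 then 0 else e (i - 1)) - (if i \<le> j then real j * e i else 0)) / real (Suc j)" for i
  have "real (w choose Suc j) = (\<Sum>i\<le>Suc j. e' i * real w ^ i)" for w
  proof -
    have "Suc j * (w choose Suc j) + j * (w choose j) = w * (w choose j)"
    proof (cases "j \<le> w")
      case True
      have "Suc j * (w choose Suc j) = (w - j) * (w choose j)"
        by (metis binomial_absorption binomial_absorb_comp)
      hence "Suc j * (w choose Suc j) + j * (w choose j) = ((w - j) + j) * (w choose j)"
        by (simp only: distrib_right)
      thus ?thesis using True by simp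
    qed (simp add: binomial_eq_0)
    hence "real (Suc j) * real (w choose Suc j) + real j * real (w choose j) = real w * real (w choose j)"
      by (metis of_nat_add of_nat_mult)
    hence "real (Suc j) * real (w choose Suc j)
        = real w * (\<Sum>i\<le>j. e i * real w ^ i) - real j * (\<Sum>i\<le>j. e i * real w ^ i)"
      by (simp add: e)
    also have "real w * (\<Sum>i\<le>j. e i * real w ^ i) = (\<Sum>i\<le>Suc j. (if i = 0 then 0 else e (i - 1)) * real w ^ i)"
      by (subst sum.atMost_Suc_shift) (simp add: sum_distrib_left algebra_simps)
    also have "real j * (\<Sum>i\<le>j. e i * real w ^ i) = (\<Sum>i\<le>Suc j. (if i \<le> j then real j * e i else 0) * real w ^ i)"
      by (simp add: sum_distrib_left algebra_simps)
    also have "(\<Sum>i\<le>Suc j. (if i = 0 then 0 else e (i - 1)) * real w ^ i)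
        - (\<Sum>i\<le>Suc j. (if i \<le> j then real j * e i else 0) * real w ^ i)
        = (\<Sum>i\<le>Suc j. real (Suc j) * (e' i * real w ^ i))"
      unfolding sum_subtractf[symmetric]
      by (intro sum.cong refl) (simp add: e'_def left_diff_distrib[symmetric] del: of_nat_Suc)
    finally have "real (Suc j) * real (w choose Suc j) = (\<Sum>i\<le>Suc j. real (Suc j) * (e' i * real w ^ i))" .
    thus ?thesis by (simp add: sum_distrib_left[symmetric] del: sum.atMost_Suc of_nat_Suc)
  qed
  thus ?case by blast
qed

text \<open>
  The quadratic form of the Hankel matrix of \<open>s\<close> at the coefficient vector of
  \<open>p\<close>; equivalently, the linear functional that sends \<open>x\<^sup>k\<close> to
  \<open>s k\<close>, evaluated at \<open>p\<^sup>2\<close>. The latter reading explains the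
  value at geometric sequences, on which the choice of \<open>p\<close> below rests.
\<close>
definition hankel_form :: "real poly \<Rightarrow> (nat \<Rightarrow> real) \<Rightarrow> real" where
  "hankel_form p s = (\<Sum>i\<le>degree p. \<Sum>j\<le>degree p. coeff p i * coeff p j * s (i + j))"

lemma hankel_form_power: "hankel_form p (\<lambda>k. \<theta> ^ k) = (poly p \<theta>)\<^sup>2"
  by (simp add: hankel_form_def poly_altdef power2_eq_square sum_product power_add algebra_simps)

lemma hankel_form_sum:
  "hankel_form p (\<lambda>k. \<Sum>a\<in>A. e a * s a k) = (\<Sum>a\<in>A. e a * hankel_form p (s a))"
proof -
  have "hankel_form p (\<lambda>k. \<Sum>a\<in>A. e a * s a k) =
     (\<Sum>i\<le>degree p. \<Sum>j\<le>degree p. \<Sum>a\<in>A. e a * (coeff p i * coeff p j * s a (i + j)))"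
    by (simp add: hankel_form_def sum_distrib_left algebra_simps)
  also have "\<dots> = (\<Sum>i\<le>degree p. \<Sum>a\<in>A. \<Sum>j\<le>degree p. e a * (coeff p i * coeff p j * s a (i + j)))"
    by (intro sum.cong refl sum.swap)
  also have "\<dots> = (\<Sum>a\<in>A. \<Sum>i\<le>degree p. \<Sum>j\<le>degree p. e a * (coeff p i * coeff p j * s a (i + j)))"
    by (rule sum.swap)
  finally show ?thesis by (simp add: hankel_form_def sum_distrib_left)
qed

definition monomial_value :: "nat list \<Rightarrow> nat list \<Rightarrow> nat" where
  "monomial_value qs \<delta> = prod_list (map2 (^) qs \<delta>)"

text \<open>
  Each factor \<open>q\<^sup>k choose j\<close> is a combination of the powers
  \<open>(q\<^sup>k)\<^sup>i\<close> with \<open>i \<le> j\<close>, so the product is a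
  combination of geometric sequences whose ratios are \<open>\<theta>\<close> times the values
  of the monomials dividing \<open>\<gamma>\<close>. The ratio \<open>\<theta>\<close>
  accumulates the factors already expanded in the induction.
\<close>
lemma hankel_form_binomials_eq_0:
  assumes "length \<gamma> = length qs"
    and "\<And>\<delta>. list_all2 (\<le>) \<delta> \<gamma> \<Longrightarrow> poly p (\<theta> * real (monomial_value qs \<delta>)) = 0"
  shows "hankel_form p (\<lambda>k. \<theta> ^ k * prod_list (map2 (\<lambda>q j. real (q ^ k choose j)) qs \<gamma>)) = 0"
  using assms
proof (induction qs arbitrary: \<gamma> \<theta>)
  case Nil
  thus ?case by (simp add: hankel_form_power monomial_value_def)
next
  case (Cons q qs)
  then obtain j \<gamma>' where \<gamma>: "\<gamma> = j # \<gamma>'" "length \<gamma>' = length qs" by (cases \<gamma>) auto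
  obtain e where e: "\<And>w. real (w choose j) = (\<Sum>i\<le>j. e i * real w ^ i)"
    using binomial_as_polynomial by blast
  let ?r = "\<lambda>k. prod_list (map2 (\<lambda>q j. real (q ^ k choose j)) qs \<gamma>')"
  have "hankel_form p (\<lambda>k. \<theta> ^ k * prod_list (map2 (\<lambda>q j. real (q ^ k choose j)) (q # qs) \<gamma>))
      = hankel_form p (\<lambda>k. \<Sum>i\<le>j. e i * ((\<theta> * real q ^ i) ^ k * ?r k))"
    by (simp add: \<gamma> e sum_distrib_left sum_distrib_right power_mult_distrib power_mult[symmetric] algebra_simps)
  also have "\<dots> = (\<Sum>i\<le>j. e i * hankel_form p (\<lambda>k. (\<theta> * real q ^ i) ^ k * ?r k))"
    by (rule hankel_form_sum)
  also have "\<dots> = 0"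
  proof (intro sum.neutral ballI)
    fix i assume "i \<in> {..j}"
    have "poly p (\<theta> * real q ^ i * real (monomial_value qs \<delta>)) = 0" if "list_all2 (\<le>) \<delta> \<gamma>'" for \<delta>
      using Cons.prems(2)[of "i # \<delta>"] that \<open>i \<in> {..j}\<close>
      by (simp add: \<gamma> monomial_value_def algebra_simps)
    hence "hankel_form p (\<lambda>k. (\<theta> * real q ^ i) ^ k * ?r k) = 0"
      using \<gamma> by (intro Cons.IH) auto
    thus "e i * hankel_form p (\<lambda>k. (\<theta> * real q ^ i) ^ k * ?r k) = 0" by simp
  qed
  finally show ?case .
qed

primrec digits_value :: "nat \<Rightarrow> nat list \<Rightarrow> nat" where
  "digits_value B [] = 0"
| "digits_value B (d # ds) = d + B * digits_value B ds"

lemma digits_value_inject: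
  assumes "length ds = length es" "set ds \<subseteq> {..<B}" "set es \<subseteq> {..<B}"
    and "digits_value B ds = digits_value B es"
  shows "ds = es"
  using assms
proof (induction ds es rule: list_induct2)
  case (Cons d ds e es)
  hence "d < B" "e < B" and eq: "d + B * digits_value B ds = e + B * digits_value B es" by auto
  hence "d = e" by (metis mod_mult_self2 mod_less)
  with eq Cons \<open>d < B\<close> show ?case by simp
qed simp

lemma monomial_value_powers:
  "monomial_value (map (\<lambda>l. 2 ^ (B ^ (s + l))) [0..<n]) \<delta> = 2 ^ (B ^ s * digits_value B \<delta>)"
  if "length \<delta> = n"
  using that
proof (induction \<delta> arbitrary: n s)
  case (Cons d \<delta>)
  then obtain m where m: "n = Suc m" "length \<delta> = m" by auto
  have "map (\<lambda>l. (2::nat) ^ (B ^ (s + l))) [0..<n] = 2 ^ (B ^ s) # map (\<lambda>l. 2 ^ (B ^ (Suc s + l))) [0..<m]"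
    unfolding m by (subst upt_conv_Cons) (simp_all add: map_Suc_upt[symmetric] del: upt_Suc map_Suc_upt)
  thus ?case using Cons.IH[of m "Suc s"] m
    by (simp add: monomial_value_def power_mult[symmetric] power_add[symmetric] algebra_simps del: upt_Suc)
qed (simp add: monomial_value_def)

text \<open>
  With \<open>q\<^sub>l = 2\<^bsup>B\<^sup>l\<^esup>\<close> the value of a monomial is
  \<open>2\<close> to the number whose digits in base \<open>B\<close> are the exponents, so for
  \<open>B > n\<close> it determines exponents that are at most \<open>n\<close>.
\<close>
lemma exists_separating_bases:
  "\<exists>qs. length qs = n \<and> (\<forall>q\<in>set qs. 1 \<le> q) \<and>
     (\<forall>\<delta>. length \<delta> = n \<and> set \<delta> \<subseteq> {..n} \<and> monomial_value qs \<delta> = prod_list qs \<longrightarrow> \<delta> = replicate n 1)"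
proof (intro exI conjI allI impI)
  let ?B = "n + 2"
  let ?qs = "map (\<lambda>l. (2::nat) ^ (?B ^ l)) [0..<n]"
  have val: "monomial_value ?qs \<delta> = 2 ^ digits_value ?B \<delta>" if "length \<delta> = n" for \<delta>
    using monomial_value_powers[OF that, of ?B 0] by simp
  have one: "monomial_value qs (replicate (length qs) 1) = prod_list qs" for qs
    by (induction qs) (auto simp: monomial_value_def)
  fix \<delta> assume \<delta>: "length \<delta> = n \<and> set \<delta> \<subseteq> {..n} \<and> monomial_value ?qs \<delta> = prod_list ?qs"
  hence "digits_value ?B \<delta> = digits_value ?B (replicate n 1)"
    using val[of \<delta>] val[of "replicate n 1"] one[of ?qs] by simp
  thus "\<delta> = replicate n 1" using \<delta>
    by (intro digits_value_inject[of _ _ ?B]) (auto simp: set_replicate_conv_if)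
qed auto

lemma ones_of_sum_le:
  "list_all2 (\<le>) (replicate n 1) \<gamma> \<Longrightarrow> sum_list \<gamma> \<le> n \<Longrightarrow> \<gamma> = replicate n (1::nat)"
proof (induction n arbitrary: \<gamma>)
  case (Suc n)
  then obtain g \<gamma>' where \<gamma>: "\<gamma> = g # \<gamma>'" "1 \<le> g" "list_all2 (\<le>) (replicate n 1) \<gamma>'"
    by (cases \<gamma>) auto
  have "sum_list (replicate n 1) \<le> sum_list \<gamma>'" using \<gamma>(3)
    by (induction rule: list_all2_induct) auto
  hence "n \<le> sum_list \<gamma>'" by (simp add: sum_list_replicate)
  with Suc \<gamma> show ?case by simp
qed simp

text \<open>
  The polynomial \<open>p\<close> has as roots the values of all monomials with exponents at
  most \<open>n\<close>, except for the product of all the bases. An exponent vector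
  \<open>\<gamma>\<close> of degree at most \<open>n\<close> other than \<open>(1, \<dots>,
  1)\<close> does not dominate \<open>(1, \<dots>, 1)\<close>, so every monomial dividing it is
  among the roots.
\<close>
lemma exists_isolating_polynomial:
  "\<exists>qs p. length qs = n \<and> (\<forall>q\<in>set qs. 1 \<le> q) \<and> poly p (real (prod_list qs)) \<noteq> 0 \<and>
     (\<forall>\<gamma>. length \<gamma> = n \<and> sum_list \<gamma> \<le> n \<and> \<gamma> \<noteq> replicate n 1 \<longrightarrow>
        hankel_form p (\<lambda>k. prod_list (map2 (\<lambda>q j. real (q ^ k choose j)) qs \<gamma>)) = 0)"
proof -
  obtain qs where qs: "length qs = n" "\<forall>q\<in>set qs. 1 \<le> q"
    and sep: "\<And>\<delta>. length \<delta> = n \<Longrightarrow> set \<delta> \<subseteq> {..n} \<Longrightarrow> monomial_value qs \<delta> = prod_list qs \<Longrightarrow> \<delta> = replicate n 1"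
    using exists_separating_bases[of n] by blast
  define Z where "Z = (\<lambda>\<delta>. real (monomial_value qs \<delta>)) ` {\<delta>. set \<delta> \<subseteq> {..n} \<and> length \<delta> = n} - {real (prod_list qs)}"
  have fin: "finite Z" unfolding Z_def by (intro finite_Diff finite_imageI finite_lists_length_eq) simp
  define p where "p = (\<Prod>z\<in>Z. [:- z, 1:])"
  have root: "poly p x = 0 \<longleftrightarrow> x \<in> Z" for x
    using fin by (auto simp: p_def poly_prod)
  show ?thesis
  proof (intro exI conjI allI impI)
    show "poly p (real (prod_list qs)) \<noteq> 0" unfolding root by (simp add: Z_def)
    fix \<gamma> assume \<gamma>: "length \<gamma> = n \<and> sum_list \<gamma> \<le> n \<and> \<gamma> \<noteq> replicate n 1"
    have "poly p (1 * real (monomial_value qs \<delta>)) = 0" if le: "list_all2 (\<le>) \<delta> \<gamma>" for \<delta>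
    proof -
      have len: "length \<delta> = n" using le \<gamma> by (simp add: list_all2_lengthD)
      have "sum_list \<delta> \<le> sum_list \<gamma>" using le by induction auto
      hence "set \<delta> \<subseteq> {..n}" using \<gamma> by (auto dest!: member_le_sum_list)
      moreover have "\<delta> \<noteq> replicate n 1" using ones_of_sum_le[of n \<gamma>] le \<gamma> by auto
      ultimately show ?thesis using sep[of \<delta>] len unfolding root Z_def by auto
    qed
    from hankel_form_binomials_eq_0[of \<gamma> qs p 1, OF _ this] \<gamma> qs
    show "hankel_form p (\<lambda>k. prod_list (map2 (\<lambda>q j. real (q ^ k choose j)) qs \<gamma>)) = 0" by simp
  qed (use qs in auto)
qed

section \<open>Averages over lattice translates\<close>

definition block_mean :: "nat \<Rightarrow> 'a::real_vector \<Rightarrow> ('a \<Rightarrow> real) \<Rightarrow> 'a \<Rightarrow> real" where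
  "block_mean L u f x = (\<Sum>i<L. f (x + real i *\<^sub>R u)) / real L"

text \<open>
  Operators that commute with translations and with finite linear combinations. The index set of
  the combinations consists of lists because the exponent vectors of the expansion below are
  lists, and a definition cannot quantify over types.
\<close>
definition transl_linear :: "(('a::real_vector \<Rightarrow> real) \<Rightarrow> 'a \<Rightarrow> real) \<Rightarrow> bool" where
  "transl_linear Q \<longleftrightarrow> (\<forall>f s x. Q (\<lambda>y. f (y + s)) x = Q f (x + s)) \<and>
     (\<forall>(e :: nat list \<Rightarrow> real) f A x. finite A \<longrightarrow>
        Q (\<lambda>y. \<Sum>a\<in>A. e a * f a y) x = (\<Sum>a\<in>A. e a * Q (f a) x))"

lemma transl_linear_fwd_diff: "transl_linear (fwd_diff v)"
  unfolding transl_linear_def fwd_diff_def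
  by (auto simp: sum_subtractf right_diff_distrib add_ac)

lemma transl_linear_block_mean: "transl_linear (block_mean L u)"
proof -
  have "(\<Sum>i<L. \<Sum>a\<in>A. e a * f a (x + real i *\<^sub>R u)) / real L
      = (\<Sum>a\<in>A. e a * ((\<Sum>i<L. f a (x + real i *\<^sub>R u)) / real L))"
    for A and e :: "nat list \<Rightarrow> real" and f x
    by (subst sum.swap) (simp add: sum_divide_distrib sum_distrib_left)
  thus ?thesis unfolding transl_linear_def block_mean_def
    by (auto simp: algebra_simps)
qed

lemma transl_linear_id: "transl_linear (\<lambda>f. f)"
  by (simp add: transl_linear_def)

lemma transl_linear_comp: "transl_linear P \<Longrightarrow> transl_linear Q \<Longrightarrow> transl_linear (\<lambda>f. P (Q f))"
proof -
  assume P: "transl_linear P" and Q: "transl_linear Q"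
  have *: "Q (\<lambda>y. f (y + s)) = (\<lambda>x. Q f (x + s))"
    "finite A \<Longrightarrow> Q (\<lambda>y. \<Sum>a\<in>A. e a * g a y) = (\<lambda>x. \<Sum>a\<in>A. e a * Q (g a) x)"
    for f s A g and e :: "nat list \<Rightarrow> real"
    using Q by (auto simp: transl_linear_def)
  show ?thesis using P unfolding transl_linear_def by (simp add: *)
qed

lemma transl_linear_funpow: "transl_linear Q \<Longrightarrow> transl_linear (Q ^^ k)"
proof (induction k)
  case (Suc k)
  from transl_linear_comp[OF Suc.prems Suc.IH[OF Suc.prems]] show ?case by (simp add: comp_def)
qed (simp add: transl_linear_id id_def)

lemma fwd_diff_scale: "fwd_diff v (\<lambda>x. c * f x) = (\<lambda>x. c * fwd_diff v f x)"
  by (rule ext) (simp add: fwd_diff_def algebra_simps)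

lemma fwd_diff_block_mean: "fwd_diff v (block_mean L u f) = block_mean L u (fwd_diff v f)"
  by (rule ext) (simp add: fwd_diff_def block_mean_def sum_subtractf diff_divide_distrib add.assoc add.commute add.left_commute)

lemma fwd_diff_funpow_block_mean:
  "fwd_diff v ((block_mean L u ^^ k) f) = (block_mean L u ^^ k) (fwd_diff v f)"
  by (induction k) (simp_all add: fwd_diff_block_mean)

lemma mixed_diff_funpow_block_mean:
  "mixed_diff vs ((block_mean L u ^^ k) f) = (block_mean L u ^^ k) (mixed_diff vs f)"
  by (induction vs) (simp_all add: fwd_diff_funpow_block_mean)

text \<open>
  The sum telescopes: a fine difference of a mean over \<open>L\<close> translates is \<open>1 /
  L\<close> times a coarse difference. This is the gain that replaces smoothness.
\<close>
lemma fwd_diff_block_mean_step: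
  "fwd_diff u (block_mean L u f) = (\<lambda>x. (1 / real L) * fwd_diff (real L *\<^sub>R u) f x)"
proof
  fix x
  have "(\<Sum>i<L. f (x + u + real i *\<^sub>R u)) - (\<Sum>i<L. f (x + real i *\<^sub>R u)) = f (x + real L *\<^sub>R u) - f x"
    by (induction L) (simp_all add: algebra_simps)
  thus "fwd_diff u (block_mean L u f) x = (1 / real L) * fwd_diff (real L *\<^sub>R u) f x"
    by (simp add: fwd_diff_def block_mean_def diff_divide_distrib[symmetric])
qed

lemma funpow_fwd_diff_block_mean:
  assumes "j \<le> k"
  shows "(fwd_diff u ^^ j) ((block_mean L u ^^ k) f) x =
    (1 / real L) ^ j * (fwd_diff (real L *\<^sub>R u) ^^ j) ((block_mean L u ^^ (k - j)) f) x"
  using assms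
proof (induction j arbitrary: x)
  case (Suc j)
  let ?D = "fwd_diff (real L *\<^sub>R u)" and ?B = "block_mean L u"
  have comm: "(?D ^^ i) (fwd_diff v g) = fwd_diff v ((?D ^^ i) g)" for i v g
    by (induction i) (simp_all add: fwd_diff_commute)
  have "(fwd_diff u ^^ Suc j) ((?B ^^ k) f) = fwd_diff u ((fwd_diff u ^^ j) ((?B ^^ k) f))" by simp
  also have "(fwd_diff u ^^ j) ((?B ^^ k) f) = (\<lambda>x. (1 / real L) ^ j * (?D ^^ j) ((?B ^^ (k - j)) f) x)"
    using Suc by auto
  also have "fwd_diff u \<dots> = (\<lambda>x. (1 / real L) ^ j * (?D ^^ j) (fwd_diff u ((?B ^^ (k - j)) f)) x)"
    by (simp add: fwd_diff_scale comm)
  also have "k - j = Suc (k - Suc j)" using Suc.prems by simp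
  also have "fwd_diff u ((?B ^^ Suc (k - Suc j)) f) = fwd_diff u (?B ((?B ^^ (k - Suc j)) f))"
    by simp
  also have "\<dots> = (\<lambda>x. (1 / real L) * ?D ((?B ^^ (k - Suc j)) f) x)"
    by (rule fwd_diff_block_mean_step)
  also have "(?D ^^ j) \<dots> = (\<lambda>x. (1 / real L) * (?D ^^ Suc j) ((?B ^^ (k - Suc j)) f) x)"
  proof -
    have "(?D ^^ i) (\<lambda>x. c * g x) = (\<lambda>x. c * (?D ^^ i) g x)" for i c g
      by (induction i) (simp_all add: fwd_diff_scale)
    moreover have "(?D ^^ Suc j) g = (?D ^^ j) (?D g)" for g by (simp add: funpow_swap1)
    ultimately show ?thesis by (simp only:)
  qed
  finally show ?case by simp
qed simp

definition smoothing :: "nat \<Rightarrow> nat \<Rightarrow> 'a::real_vector list \<Rightarrow> ('a \<Rightarrow> real) \<Rightarrow> 'a \<Rightarrow> real" where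
  "smoothing L k us f = foldr (\<lambda>u. block_mean L u ^^ k) us f"

lemma smoothing_simps [simp]:
  "smoothing L k [] f = f"
  "smoothing L k (u # us) f = (block_mean L u ^^ k) (smoothing L k us f)"
  by (simp_all add: smoothing_def)

text \<open>
  The operator that accompanies the exponent vector \<open>\<gamma>\<close> in the expansion of
  \<open>smoothing L k us f\<close>: for each direction, every difference uses up one of the
  \<open>k\<close> averages and becomes a difference with the coarse step \<open>L u\<close>.
\<close>
primrec smoothed_diff :: "nat \<Rightarrow> nat \<Rightarrow> 'a::real_vector list \<Rightarrow> nat list \<Rightarrow> ('a \<Rightarrow> real) \<Rightarrow> 'a \<Rightarrow> real" where
  "smoothed_diff L k [] \<gamma> f = f"
| "smoothed_diff L k (u # us) \<gamma> f =
     (fwd_diff (real L *\<^sub>R u) ^^ hd \<gamma>) ((block_mean L u ^^ (k - hd \<gamma>)) (smoothed_diff L k us (tl \<gamma>) f))"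

definition combination :: "nat list \<Rightarrow> 'a::real_vector list \<Rightarrow> 'a" where
  "combination ws us = sum_list (map2 (\<lambda>w u. real w *\<^sub>R u) ws us)"

lemma combination_simps [simp]:
  "combination [] us = 0"
  "combination (w # ws) (u # us) = real w *\<^sub>R u + combination ws us"
  by (simp_all add: combination_def)

definition exponents :: "nat \<Rightarrow> nat \<Rightarrow> nat list set" where
  "exponents k n = {\<gamma>. set \<gamma> \<subseteq> {..k} \<and> length \<gamma> = n}"

lemma finite_exponents [simp]: "finite (exponents k n)"
  unfolding exponents_def by (rule finite_lists_length_eq) simp

lemma sum_exponents_Suc:
  "(\<Sum>\<gamma>\<in>exponents k (Suc n). \<phi> \<gamma>) = (\<Sum>j\<le>k. \<Sum>\<gamma>\<in>exponents k n. \<phi> (j # \<gamma>))"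
  for \<phi> :: "nat list \<Rightarrow> real"
proof -
  have "exponents k (Suc n) = (\<lambda>(j, \<gamma>). j # \<gamma>) ` ({..k} \<times> exponents k n)"
    by (auto simp: exponents_def length_Suc_conv image_iff)
  moreover have inj: "inj_on (\<lambda>(j, \<gamma>). j # \<gamma>) ({..k} \<times> exponents k n)"
    by (auto simp: inj_on_def)
  ultimately have "(\<Sum>\<gamma>\<in>exponents k (Suc n). \<phi> \<gamma>) =
      (\<Sum>x\<in>{..k} \<times> exponents k n. \<phi> (case x of (j, \<gamma>) \<Rightarrow> j # \<gamma>))"
    using sum.reindex[OF inj, of \<phi>] by (simp only: comp_def)
  also have "\<dots> = (\<Sum>j\<le>k. \<Sum>\<gamma>\<in>exponents k n. \<phi> (j # \<gamma>))"
    by (simp add: sum.cartesian_product split_beta)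
  finally show ?thesis .
qed

text \<open>
  Newton's formula in every direction. It is exact, without remainder, because the number
  \<open>k\<close> of averages is at least every \<open>w\<close>, so that each fine difference
  finds an average to cancel against.
\<close>
lemma smoothing_expansion:
  assumes "length ws = length us" "set ws \<subseteq> {..k}"
  shows "smoothing L k us f (y + combination ws us) =
    (\<Sum>\<gamma>\<in>exponents k (length us). prod_list (map2 (\<lambda>w j. real (w choose j)) ws \<gamma>)
        * (1 / real L) ^ sum_list \<gamma> * smoothed_diff L k us \<gamma> f y)"
  using assms
proof (induction ws us arbitrary: y rule: list_induct2)
  case Nil
  have "exponents k 0 = {[]}" by (auto simp: exponents_def)
  thus ?case by simp
next
  case (Cons w ws u us)
  let ?c = "\<lambda>\<gamma>. prod_list (map2 (\<lambda>w j. real (w choose j)) ws \<gamma>) * (1 / real L) ^ sum_list \<gamma>"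
  let ?O = "block_mean L u ^^ k"
  let ?Q = "\<lambda>j f. (fwd_diff (real L *\<^sub>R u) ^^ j) ((block_mean L u ^^ (k - j)) f)"
  define h where "h = (\<lambda>z. smoothing L k us f (z + combination ws us))"
  have h: "h = (\<lambda>z. \<Sum>\<gamma>\<in>exponents k (length us). ?c \<gamma> * smoothed_diff L k us \<gamma> f z)"
    unfolding h_def using Cons.prems by (intro ext Cons.IH) simp
  have "transl_linear ?O" by (intro transl_linear_funpow transl_linear_block_mean)
  hence O: "?O h x = ?O (smoothing L k us f) (x + combination ws us)" for x
    unfolding h_def transl_linear_def by blast
  have Q: "transl_linear (?Q j)" for j
    by (rule transl_linear_comp[OF transl_linear_funpow[OF transl_linear_fwd_diff]
          transl_linear_funpow[OF transl_linear_block_mean]])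
  have Qh: "?Q j h y = (\<Sum>\<gamma>\<in>exponents k (length us). ?c \<gamma> * ?Q j (smoothed_diff L k us \<gamma> f) y)" for j
    using Q[of j] unfolding h transl_linear_def by (meson finite_exponents)
  have wk: "w \<le> k" using Cons.prems by simp
  have "smoothing L k (u # us) f (y + combination (w # ws) (u # us)) = ?O h (y + real w *\<^sub>R u)"
    unfolding O by (simp add: add.assoc)
  also have "\<dots> = (\<Sum>j\<le>w. real (w choose j) * (fwd_diff u ^^ j) (?O h) y)"
    by (rule newton_forward)
  also have "\<dots> = (\<Sum>j\<le>k. real (w choose j) * (fwd_diff u ^^ j) (?O h) y)"
    using wk by (intro sum.mono_neutral_left) (auto simp: binomial_eq_0)
  also have "\<dots> = (\<Sum>j\<le>k. real (w choose j) * ((1 / real L) ^ j * ?Q j h y))"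
    by (intro sum.cong refl) (simp add: funpow_fwd_diff_block_mean del: power_divide)
  also have "\<dots> = (\<Sum>j\<le>k. \<Sum>\<gamma>\<in>exponents k (length us).
      real (w choose j) * ((1 / real L) ^ j * (?c \<gamma> * ?Q j (smoothed_diff L k us \<gamma> f) y)))"
    unfolding Qh by (simp only: sum_distrib_left)
  also have "\<dots> = (\<Sum>\<gamma>\<in>exponents k (length (u # us)). prod_list (map2 (\<lambda>w j. real (w choose j)) (w # ws) \<gamma>)
        * (1 / real L) ^ sum_list \<gamma> * smoothed_diff L k (u # us) \<gamma> f y)"
    by (simp add: sum_exponents_Suc power_add mult_ac del: power_divide)
  finally show ?case .
qed

section \<open>Non-negative mixed differences from Hankel positivity\<close>

text \<open>
  Membership in a convex set covers both uses below: two-sided bounds and non-negativity.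
\<close>
lemma block_mean_in_convex:
  fixes u :: "'a::ordered_real_vector"
  assumes S: "convex S" and f: "\<And>z. lo \<le> z \<Longrightarrow> z \<le> hi \<Longrightarrow> f z \<in> S"
    and "0 \<le> u" "0 < L" and z: "lo \<le> z" "z \<le> hi - real L *\<^sub>R u"
  shows "block_mean L u f z \<in> S"
proof -
  have "(\<Sum>i<L. (1 / real L) *\<^sub>R f (z + real i *\<^sub>R u)) \<in> S"
  proof (rule convex_sum)
    fix i assume i: "i \<in> {..<L}"
    have "lo \<le> z + real i *\<^sub>R u" using z \<open>0 \<le> u\<close> by (simp add: add_increasing2 scaleR_nonneg_nonneg)
    moreover have "real i *\<^sub>R u \<le> real L *\<^sub>R u"
      using i \<open>0 \<le> u\<close> by (intro scaleR_right_mono) auto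
    hence "z + real i *\<^sub>R u \<le> hi" using z by (metis add_left_mono le_diff_eq order_trans)
    ultimately show "f (z + real i *\<^sub>R u) \<in> S" by (rule f)
  qed (use S \<open>0 < L\<close> in auto)
  thus ?thesis by (simp add: block_mean_def sum_divide_distrib)
qed

lemma funpow_block_mean_in_convex:
  fixes u :: "'a::ordered_real_vector"
  assumes "convex S" and "\<And>z. lo \<le> z \<Longrightarrow> z \<le> hi \<Longrightarrow> f z \<in> S"
    and "0 \<le> u" "0 < L" and "lo \<le> z" "z \<le> hi - (real k * real L) *\<^sub>R u"
  shows "(block_mean L u ^^ k) f z \<in> S"
  using assms(5-6)
proof (induction k arbitrary: z)
  case (Suc k)
  have "block_mean L u ((block_mean L u ^^ k) f) z \<in> S"
    by (rule block_mean_in_convex[OF assms(1) Suc.IH, of lo "hi - (real k * real L) *\<^sub>R u"])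
       (use Suc.prems assms in \<open>auto simp: algebra_simps\<close>)
  thus ?case by simp
qed (use assms in simp)

lemma smoothing_in_convex:
  fixes us :: "'a::ordered_real_vector list"
  assumes "convex S" and "\<And>z. lo \<le> z \<Longrightarrow> z \<le> hi \<Longrightarrow> f z \<in> S"
    and "\<forall>u\<in>set us. 0 \<le> u" "0 < L" and "lo \<le> z" "z \<le> hi - (real k * real L) *\<^sub>R sum_list us"
  shows "smoothing L k us f z \<in> S"
  using assms(3,5,6)
proof (induction us arbitrary: z)
  case (Cons u us)
  have "(block_mean L u ^^ k) (smoothing L k us f) z \<in> S"
    by (rule funpow_block_mean_in_convex[OF assms(1) Cons.IH, of lo "hi - (real k * real L) *\<^sub>R sum_list us"])
       (use Cons.prems assms in \<open>auto simp: algebra_simps\<close>)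
  thus ?case by simp
qed (use assms in simp)

lemma funpow_fwd_diff_bound:
  fixes v :: "'a::ordered_real_vector"
  assumes "\<And>z. lo \<le> z \<Longrightarrow> z \<le> hi \<Longrightarrow> \<bar>f z\<bar> \<le> C" and "0 \<le> v"
    and "lo \<le> z" "z \<le> hi - real j *\<^sub>R v"
  shows "\<bar>(fwd_diff v ^^ j) f z\<bar> \<le> 2 ^ j * C"
  using assms(3,4)
proof (induction j arbitrary: z)
  case (Suc j)
  have hi: "z + v \<le> hi - real j *\<^sub>R v" using Suc.prems by (simp add: algebra_simps)
  moreover have "z \<le> z + v" using \<open>0 \<le> v\<close> by simp
  ultimately have "\<bar>(fwd_diff v ^^ j) f z\<bar> \<le> 2 ^ j * C" "\<bar>(fwd_diff v ^^ j) f (z + v)\<bar> \<le> 2 ^ j * C"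
    using Suc.prems(1) by (meson Suc.IH order_trans)+
  moreover note funpow_fwd_diff_Suc[of j v f z]
  moreover have "(2::real) ^ Suc j * C = 2 * (2 ^ j * C)" by simp
  ultimately show ?case by linarith
qed (use assms in simp)

lemma mixed_diff_bound:
  fixes vs :: "'a::ordered_real_vector list"
  assumes "\<And>z. lo \<le> z \<Longrightarrow> z \<le> hi \<Longrightarrow> \<bar>f z\<bar> \<le> C" and "\<forall>v\<in>set vs. 0 \<le> v"
    and "lo \<le> z" "z \<le> hi - sum_list vs"
  shows "\<bar>mixed_diff vs f z\<bar> \<le> 2 ^ length vs * C"
  using assms(2-4)
proof (induction vs arbitrary: z)
  case (Cons v vs)
  have "\<bar>(fwd_diff v ^^ 1) (mixed_diff vs f) z\<bar> \<le> 2 ^ 1 * (2 ^ length vs * C)"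
    by (rule funpow_fwd_diff_bound[of lo "hi - sum_list vs"])
       (use Cons in \<open>auto simp: algebra_simps\<close>)
  thus ?case by simp
qed (use assms in simp)

lemma smoothed_diff_bound:
  fixes us :: "'a::ordered_real_vector list"
  assumes "\<And>z. lo \<le> z \<Longrightarrow> z \<le> hi \<Longrightarrow> \<bar>f z\<bar> \<le> C" and "\<forall>u\<in>set us. 0 \<le> u" "0 < L"
    and "\<gamma> \<in> exponents k (length us)"
    and "lo \<le> z" "z \<le> hi - (real k * real L) *\<^sub>R sum_list us"
  shows "\<bar>smoothed_diff L k us \<gamma> f z\<bar> \<le> 2 ^ sum_list \<gamma> * C"
  using assms(2,4-6)
proof (induction us arbitrary: z \<gamma>)
  case Nil
  thus ?case using assms(1) by (simp add: exponents_def)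
next
  case (Cons u us)
  then obtain j \<gamma>' where \<gamma>: "\<gamma> = j # \<gamma>'" "j \<le> k" "\<gamma>' \<in> exponents k (length us)"
    by (auto simp: exponents_def length_Suc_conv)
  let ?hi = "hi - (real k * real L) *\<^sub>R sum_list us"
  let ?g = "smoothed_diff L k us \<gamma>' f"
  let ?b = "2 ^ sum_list \<gamma>' * C"
  have g: "\<bar>?g y\<bar> \<le> ?b" if "lo \<le> y" "y \<le> ?hi" for y
    using Cons.IH[of \<gamma>' y] Cons.prems \<gamma> that by simp
  have "\<bar>(fwd_diff (real L *\<^sub>R u) ^^ j) ((block_mean L u ^^ (k - j)) ?g) z\<bar> \<le> 2 ^ j * ?b"
  proof (rule funpow_fwd_diff_bound[of lo "?hi - (real (k - j) * real L) *\<^sub>R u"])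
    fix y assume y: "lo \<le> y" "y \<le> ?hi - (real (k - j) * real L) *\<^sub>R u"
    have "(block_mean L u ^^ (k - j)) ?g y \<in> {- ?b..?b}"
      by (rule funpow_block_mean_in_convex[of _ lo ?hi])
         (use g y Cons.prems assms in \<open>auto simp: abs_le_iff minus_le_iff\<close>)
    thus "\<bar>(block_mean L u ^^ (k - j)) ?g y\<bar> \<le> ?b" by (simp add: abs_le_iff minus_le_iff)
  next
    have "real (k - j) = real k - real j" using \<gamma> by (simp add: of_nat_diff)
    hence eq: "?hi - (real (k - j) * real L) *\<^sub>R u - real j *\<^sub>R (real L *\<^sub>R u)
        = hi - (real k * real L) *\<^sub>R sum_list (u # us)"
      by (simp add: algebra_simps)
    thus "z \<le> ?hi - (real (k - j) * real L) *\<^sub>R u - real j *\<^sub>R (real L *\<^sub>R u)"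
      using Cons.prems(4) by (simp only: eq)
  qed (use Cons.prems in \<open>auto intro: scaleR_nonneg_nonneg\<close>)
  thus ?case by (simp add: \<gamma> power_add mult_ac)
qed

text \<open>
  The leading term of the expansion is a coarse mixed difference of an average of
  \<open>f\<close>.
\<close>
lemma smoothed_diff_ones:
  "smoothed_diff L (Suc k) us (replicate (length us) 1) f
     = mixed_diff (map (\<lambda>u. real L *\<^sub>R u) us) (smoothing L k us f)"
  by (induction us) (simp_all add: mixed_diff_funpow_block_mean fwd_diff_funpow_block_mean)

text \<open>
  What positivity on Hankel matrices provides for one real function: the arguments \<open>y +
  \<Sum>\<^sub>l q\<^sub>l\<^bsup>i+j\<^esup> u\<^sub>l\<close> are the entries of Hankel
  matrices that are positive, being sums of a constant matrix and of multiples of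
  \<open>(q\<^sub>l\<^sup>i q\<^sub>l\<^sup>j)\<close>. Since they increase with \<open>i +
  j\<close>, only the largest one has to be bounded by \<open>hi\<close>.
\<close>
definition hankel_positive :: "('a::ordered_real_vector \<Rightarrow> real) \<Rightarrow> 'a \<Rightarrow> 'a \<Rightarrow> bool" where
  "hankel_positive f lo hi \<longleftrightarrow>
     (\<forall>us qs p y. length qs = length us \<longrightarrow> (\<forall>u\<in>set us. 0 \<le> u) \<longrightarrow> (\<forall>q\<in>set qs. 1 \<le> q) \<longrightarrow>
        lo \<le> y \<longrightarrow> y + combination (map (\<lambda>q. q ^ (2 * degree p)) qs) us \<le> hi \<longrightarrow>
        0 \<le> hankel_form p (\<lambda>k. f (y + combination (map (\<lambda>q. q ^ k) qs) us)))"

lemma hankel_positiveD: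
  assumes "hankel_positive f lo hi" "length qs = length us" "\<And>u. u \<in> set us \<Longrightarrow> 0 \<le> u"
    "\<And>q. q \<in> set qs \<Longrightarrow> 1 \<le> q" "lo \<le> y"
    "y + combination (map (\<lambda>q. q ^ (2 * degree p)) qs) us \<le> hi"
  shows "0 \<le> hankel_form p (\<lambda>k. f (y + combination (map (\<lambda>q. q ^ k) qs) us))"
  using assms unfolding hankel_positive_def by blast

lemma hankel_form_block_mean:
  "(\<lambda>y. hankel_form p (\<lambda>t. block_mean L u f (y + s t)))
     = block_mean L u (\<lambda>y. hankel_form p (\<lambda>t. f (y + s t)))"
proof
  fix y
  have "hankel_form p (\<lambda>t. block_mean L u f (y + s t))
      = hankel_form p (\<lambda>t. \<Sum>i<L. (1 / real L) * f (y + s t + real i *\<^sub>R u))"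
    by (simp add: block_mean_def sum_divide_distrib)
  also have "\<dots> = (\<Sum>i<L. (1 / real L) * hankel_form p (\<lambda>t. f (y + s t + real i *\<^sub>R u)))"
    by (rule hankel_form_sum)
  finally show "hankel_form p (\<lambda>t. block_mean L u f (y + s t))
     = block_mean L u (\<lambda>y. hankel_form p (\<lambda>t. f (y + s t))) y"
    by (simp add: block_mean_def sum_divide_distrib add_ac)
qed

lemma hankel_form_funpow_block_mean:
  "(\<lambda>y. hankel_form p (\<lambda>t. (block_mean L u ^^ k) f (y + s t)))
     = (block_mean L u ^^ k) (\<lambda>y. hankel_form p (\<lambda>t. f (y + s t)))"
  by (induction k) (simp_all add: hankel_form_block_mean)

text \<open>
  Averaging over translates preserves the sign of the Hankel form, because the form commutes
  with it.
\<close>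
lemma hankel_form_smoothing:
  "(\<lambda>y. hankel_form p (\<lambda>t. smoothing L k us f (y + s t)))
     = smoothing L k us (\<lambda>y. hankel_form p (\<lambda>t. f (y + s t)))"
  by (induction us) (simp_all add: hankel_form_funpow_block_mean)

lemma hankel_form_cong:
  "(\<And>t. t \<le> 2 * degree p \<Longrightarrow> s t = s' t) \<Longrightarrow> hankel_form p s = hankel_form p s'"
  unfolding hankel_form_def by (intro sum.cong refl) auto

lemma combination_nonneg:
  "length ws = length us \<Longrightarrow> \<forall>u\<in>set us. 0 \<le> u \<Longrightarrow> 0 \<le> combination ws (us :: 'a::ordered_real_vector list)"
  by (induction ws us rule: list_induct2) (auto intro!: add_nonneg_nonneg scaleR_nonneg_nonneg)

lemma combination_power_mono:
  fixes us :: "'a::ordered_real_vector list"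
  assumes "length qs = length us" "\<forall>u\<in>set us. 0 \<le> u" "\<forall>q\<in>set qs. 1 \<le> q" "n \<le> n'"
  shows "combination (map (\<lambda>q. q ^ n) qs) us \<le> combination (map (\<lambda>q. q ^ n') qs) us"
  using assms(1-3)
proof (induction qs us rule: list_induct2)
  case (Cons q qs u us)
  have "real (q ^ n) \<le> real (q ^ n')" using Cons.prems assms(4) by (simp add: power_increasing)
  thus ?case using Cons by (auto intro!: add_mono scaleR_right_mono simp del: of_nat_power)
qed simp

lemma combination_le:
  fixes us :: "'a::ordered_real_vector list"
  assumes "length ws = length us" "\<forall>u\<in>set us. 0 \<le> u" "\<forall>w\<in>set ws. w \<le> k"
  shows "combination ws us \<le> real k *\<^sub>R sum_list us"
  using assms
  by (induction ws us rule: list_induct2) (auto simp: scaleR_add_right intro!: add_mono scaleR_right_mono)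

text \<open>
  Insert the expansion of \<open>smoothing\<close> into the Hankel form of the isolating
  polynomial. The terms of degree at most \<open>n\<close> vanish except for that of \<open>(1,
  \<dots>, 1)\<close>, which carries \<open>L\<^bsup>-n\<^esup>\<close> and a positive
  coefficient; the remaining ones are \<open>O(L\<^bsup>-n-1\<^esup>)\<close>. The constants
  \<open>k\<close> and \<open>D\<close> depend neither on the coarse steps \<open>hs\<close> nor
  on \<open>L\<close>, which is what allows the two limits to be taken one after the other.
\<close>
lemma smoothed_mixed_diff_lower_bound:
  fixes f :: "'a::ordered_real_vector \<Rightarrow> real"
  assumes pos: "hankel_positive f lo hi"
    and bound: "\<And>z. lo \<le> z \<Longrightarrow> z \<le> hi \<Longrightarrow> \<bar>f z\<bar> \<le> C" and "0 \<le> C"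
  shows "\<exists>k D. 0 \<le> D \<and> (\<forall>hs L y. length hs = n \<longrightarrow> (\<forall>h\<in>set hs. 0 \<le> h) \<longrightarrow> 0 < L \<longrightarrow> lo \<le> y \<longrightarrow>
     y + real (2 * Suc k) *\<^sub>R sum_list hs \<le> hi \<longrightarrow>
     - (D / real L) \<le> mixed_diff hs (smoothing L k (map (\<lambda>h. (1 / real L) *\<^sub>R h) hs) f) y)"
proof -
  obtain qs p where qs: "length qs = n" "\<forall>q\<in>set qs. 1 \<le> q"
    and p1: "poly p (real (prod_list qs)) \<noteq> 0"
    and p0: "\<And>\<gamma>. length \<gamma> = n \<Longrightarrow> sum_list \<gamma> \<le> n \<Longrightarrow> \<gamma> \<noteq> replicate n 1 \<Longrightarrow>
        hankel_form p (\<lambda>k. prod_list (map2 (\<lambda>q j. real (q ^ k choose j)) qs \<gamma>)) = 0"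
    using exists_isolating_polynomial[of n] by blast
  define \<kappa> where "\<kappa> \<gamma> = hankel_form p (\<lambda>k. prod_list (map2 (\<lambda>q j. real (q ^ k choose j)) qs \<gamma>))" for \<gamma>
  have "prod_list (map2 (\<lambda>q j. real (q ^ k choose j)) rs (replicate (length rs) 1)) = real (prod_list rs) ^ k" for k rs
    by (induction rs) (simp_all add: power_mult_distrib)
  hence "\<kappa> (replicate n 1) = (poly p (real (prod_list qs)))\<^sup>2"
    unfolding \<kappa>_def qs(1)[symmetric] by (simp only: hankel_form_power)
  hence \<kappa>1: "0 < \<kappa> (replicate n 1)" using p1 by simp
  \<comment> \<open>\<open>k + 1\<close> averages exceed every exponent \<open>q\<^sup>t\<close> with \<open>t \<le> 2 degree p\<close>; the leading term uses up one of them\<close>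
  define k where "k = sum_list (map (\<lambda>q. q ^ (2 * degree p)) qs)"
  define E where "E = exponents (Suc k) n"
  define D where "D = (\<Sum>\<gamma>\<in>E. \<bar>\<kappa> \<gamma>\<bar> * (2 ^ sum_list \<gamma> * C)) / \<kappa> (replicate n 1)"
  have D: "0 \<le> D" unfolding D_def using \<kappa>1 \<open>0 \<le> C\<close> by (intro divide_nonneg_pos sum_nonneg) auto
  have small: "q ^ t \<le> Suc k" if "q \<in> set qs" "t \<le> 2 * degree p" for q t
  proof -
    have "q ^ t \<le> q ^ (2 * degree p)" using that qs by (intro power_increasing) auto
    also have "\<dots> \<le> k" unfolding k_def using that by (intro member_le_sum_list) auto
    finally show ?thesis by simp
  qed
  have "- (D / real L) \<le> mixed_diff hs (smoothing L k (map (\<lambda>h. (1 / real L) *\<^sub>R h) hs) f) y"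
    if hs: "length hs = n" "\<forall>h\<in>set hs. 0 \<le> h" and L: "0 < L" and y: "lo \<le> y"
      "y + real (2 * Suc k) *\<^sub>R sum_list hs \<le> hi" for hs L y
  proof -
    define us where "us = map (\<lambda>h. (1 / real L) *\<^sub>R h) hs"
    have us: "length us = n" "\<forall>u\<in>set us. 0 \<le> u" using hs by (auto simp: us_def scaleR_nonneg_nonneg)
    have hs_us: "map (\<lambda>u. real L *\<^sub>R u) us = hs" using L by (simp add: us_def comp_def)
    have sum_us: "sum_list us = (1 / real L) *\<^sub>R sum_list hs"
      unfolding us_def by (induction hs) (simp_all add: scaleR_add_right)
    have sum_hs: "0 \<le> sum_list hs" using hs(2) by (intro sum_list_nonneg) auto
    have us_le_hs: "sum_list us \<le> sum_list hs"
    proof -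
      have "(1 / real L) *\<^sub>R sum_list hs \<le> 1 *\<^sub>R sum_list hs"
        using L by (intro scaleR_right_mono sum_hs) auto
      thus ?thesis by (simp add: sum_us)
    qed
    let ?T = "\<lambda>\<gamma>. smoothed_diff L (Suc k) us \<gamma> f y"
    have "y + real (Suc k) *\<^sub>R sum_list hs \<le> y + real (2 * Suc k) *\<^sub>R sum_list hs"
      by (intro add_left_mono scaleR_right_mono sum_hs) simp
    hence y1: "y + real (Suc k) *\<^sub>R sum_list hs \<le> hi" using y by (meson order_trans)
    have T: "\<bar>?T \<gamma>\<bar> \<le> 2 ^ sum_list \<gamma> * C" if "\<gamma> \<in> E" for \<gamma>
      by (rule smoothed_diff_bound[of lo hi])
         (use that y1 y us L bound in \<open>auto simp: E_def sum_us le_diff_eq\<close>)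
    \<comment> \<open>the averages and the Hankel arguments together reach at most \<open>2 (k + 1)\<close> coarse steps\<close>
    have "0 \<le> smoothing L (Suc k) us (\<lambda>y. hankel_form p (\<lambda>t. f (y + combination (map (\<lambda>q. q ^ t) qs) us))) y"
    proof -
      have "smoothing L (Suc k) us (\<lambda>y. hankel_form p (\<lambda>t. f (y + combination (map (\<lambda>q. q ^ t) qs) us))) y \<in> {0..}"
      proof (rule smoothing_in_convex[of _ lo "hi - real (Suc k) *\<^sub>R sum_list hs"])
        fix z assume z: "lo \<le> z" "z \<le> hi - real (Suc k) *\<^sub>R sum_list hs"
        have "combination (map (\<lambda>q. q ^ (2 * degree p)) qs) us \<le> real (Suc k) *\<^sub>R sum_list us"
          using us qs small by (intro combination_le) auto
        also have "\<dots> \<le> real (Suc k) *\<^sub>R sum_list hs"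
          by (rule scaleR_left_mono[OF us_le_hs]) simp
        finally have "z + combination (map (\<lambda>q. q ^ (2 * degree p)) qs) us \<le> z + real (Suc k) *\<^sub>R sum_list hs"
          by (rule add_left_mono)
        also have "\<dots> \<le> hi" using z(2) by (simp only: le_diff_eq)
        finally have "z + combination (map (\<lambda>q. q ^ (2 * degree p)) qs) us \<le> hi" .
        thus "hankel_form p (\<lambda>t. f (z + combination (map (\<lambda>q. q ^ t) qs) us)) \<in> {0..}"
          using hankel_positiveD[OF pos, of qs us z p] us qs z(1) by simp
      next
        show "y \<le> hi - real (Suc k) *\<^sub>R sum_list hs - (real (Suc k) * real L) *\<^sub>R sum_list us"
        proof -
          have "real (2 * Suc k) *\<^sub>R sum_list hs = real (Suc k) *\<^sub>R sum_list hs + real (Suc k) *\<^sub>R sum_list hs"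
            unfolding scaleR_add_left[symmetric] by simp
          moreover have "(real (Suc k) * real L) *\<^sub>R sum_list us = real (Suc k) *\<^sub>R sum_list hs"
            using L by (simp add: sum_us)
          ultimately show ?thesis using y(2) by (simp only: le_diff_eq add.assoc)
        qed
        show "lo \<le> y" by (rule y(1))
      qed (use us L in auto)
      thus ?thesis by simp
    qed
    also have "\<dots> = hankel_form p (\<lambda>t. smoothing L (Suc k) us f (y + combination (map (\<lambda>q. q ^ t) qs) us))"
      by (subst hankel_form_smoothing[symmetric]) simp
    also have "\<dots> = hankel_form p (\<lambda>t. \<Sum>\<gamma>\<in>E. ((1 / real L) ^ sum_list \<gamma> * ?T \<gamma>) *
        prod_list (map2 (\<lambda>q j. real (q ^ t choose j)) qs \<gamma>))"
    proof (rule hankel_form_cong)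
      fix t assume "t \<le> 2 * degree p"
      hence "set (map (\<lambda>q. q ^ t) qs) \<subseteq> {..Suc k}" using small by auto
      moreover have "length (map (\<lambda>q. q ^ t) qs) = length us" using us qs by simp
      ultimately show "smoothing L (Suc k) us f (y + combination (map (\<lambda>q. q ^ t) qs) us)
        = (\<Sum>\<gamma>\<in>E. ((1 / real L) ^ sum_list \<gamma> * ?T \<gamma>) * prod_list (map2 (\<lambda>q j. real (q ^ t choose j)) qs \<gamma>))"
        by (subst smoothing_expansion)
           (auto simp: E_def us zip_map1 comp_def case_prod_unfold mult_ac simp del: power_divide)
    qed
    also have "\<dots> = (\<Sum>\<gamma>\<in>E. ((1 / real L) ^ sum_list \<gamma> * ?T \<gamma>) * \<kappa> \<gamma>)"
      unfolding \<kappa>_def by (rule hankel_form_sum)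
    also have "\<dots> = (1 / real L) ^ n * ?T (replicate n 1) * \<kappa> (replicate n 1)
        + (\<Sum>\<gamma>\<in>E - {replicate n 1}. ((1 / real L) ^ sum_list \<gamma> * ?T \<gamma>) * \<kappa> \<gamma>)"
      by (subst sum.remove[of E "replicate n 1"]) (auto simp: E_def exponents_def sum_list_replicate
          intro: finite_exponents[unfolded exponents_def])
    also have "(\<Sum>\<gamma>\<in>E - {replicate n 1}. ((1 / real L) ^ sum_list \<gamma> * ?T \<gamma>) * \<kappa> \<gamma>)
        \<le> (\<Sum>\<gamma>\<in>E - {replicate n 1}. (1 / real L) ^ Suc n * (\<bar>\<kappa> \<gamma>\<bar> * (2 ^ sum_list \<gamma> * C)))"
    proof (intro sum_mono)
      fix \<gamma> assume \<gamma>: "\<gamma> \<in> E - {replicate n 1}"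
      show "((1 / real L) ^ sum_list \<gamma> * ?T \<gamma>) * \<kappa> \<gamma> \<le> (1 / real L) ^ Suc n * (\<bar>\<kappa> \<gamma>\<bar> * (2 ^ sum_list \<gamma> * C))"
      proof (cases "sum_list \<gamma> \<le> n")
        case True
        hence "\<kappa> \<gamma> = 0" unfolding \<kappa>_def using \<gamma> by (intro p0) (auto simp: E_def exponents_def)
        thus ?thesis by simp
      next
        case False
        have "((1 / real L) ^ sum_list \<gamma> * ?T \<gamma>) * \<kappa> \<gamma> \<le> \<bar>((1 / real L) ^ sum_list \<gamma> * ?T \<gamma>) * \<kappa> \<gamma>\<bar>"
          by (rule abs_ge_self)
        also have "\<dots> = (1 / real L) ^ sum_list \<gamma> * (\<bar>\<kappa> \<gamma>\<bar> * \<bar>?T \<gamma>\<bar>)" by (simp add: abs_mult)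
        also have "\<dots> \<le> (1 / real L) ^ Suc n * (\<bar>\<kappa> \<gamma>\<bar> * (2 ^ sum_list \<gamma> * C))"
          using False L T[of \<gamma>] \<gamma>
          by (intro mult_mono power_decreasing mult_left_mono) auto
        finally show ?thesis .
      qed
    qed
    also have "\<dots> \<le> (\<Sum>\<gamma>\<in>E. (1 / real L) ^ Suc n * (\<bar>\<kappa> \<gamma>\<bar> * (2 ^ sum_list \<gamma> * C)))"
      using \<open>0 \<le> C\<close> by (intro sum_mono2) (auto simp: E_def)
    also have "\<dots> = (1 / real L) ^ n * ((D / real L) * \<kappa> (replicate n 1))"
    proof -
      have "(\<Sum>\<gamma>\<in>E. \<bar>\<kappa> \<gamma>\<bar> * (2 ^ sum_list \<gamma> * C)) = D * \<kappa> (replicate n 1)"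
        using \<kappa>1 by (simp add: D_def)
      thus ?thesis unfolding sum_distrib_left[symmetric] by simp
    qed
    finally have "0 \<le> (1 / real L) ^ n * (\<kappa> (replicate n 1) * (?T (replicate n 1) + D / real L))"
      by (simp add: algebra_simps)
    hence "0 \<le> ?T (replicate n 1) + D / real L"
      using \<kappa>1 L by (metis mult_le_cancel_left_pos mult_zero_right of_nat_0_less_iff zero_less_divide_1_iff zero_less_power)
    moreover have "?T (replicate n 1) = mixed_diff hs (smoothing L k us f) y"
      using smoothed_diff_ones[of L k us f] us hs_us by simp
    ultimately show ?thesis by (simp add: us_def)
  qed
  thus ?thesis using D by blast
qed

text \<open>
  A mixed difference is the sum of the \<open>M\<^sup>n\<close> mixed differences over the cells
  of a subdivision.
\<close>
lemma mixed_diff_subdivide_lower: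
  fixes vs :: "'a::ordered_real_vector list"
  assumes "0 < M" "0 \<le> e" and vs: "\<forall>v\<in>set vs. 0 \<le> v"
    and small: "\<And>y. lo \<le> y \<Longrightarrow> y \<le> hi \<Longrightarrow> - e \<le> mixed_diff (map (\<lambda>v. (1 / real M) *\<^sub>R v) vs) g y"
    and x: "lo \<le> x" "x + sum_list vs \<le> hi"
  shows "- (real M ^ length vs * e) \<le> mixed_diff vs g x"
  using vs small x
proof (induction vs arbitrary: g x)
  case (Cons v vs)
  let ?d = "(1 / real M) *\<^sub>R v"
  have v: "0 \<le> v" using Cons.prems by simp
  have "- (real M ^ length vs * e) \<le> mixed_diff vs (fwd_diff ?d g) (x + real i *\<^sub>R ?d)" if i: "i < M" for i
  proof (rule Cons.IH)
    show "- e \<le> mixed_diff (map (\<lambda>v. (1 / real M) *\<^sub>R v) vs) (fwd_diff ?d g) y" if "lo \<le> y" "y \<le> hi" for y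
      using Cons.prems(2)[OF that] by (simp add: mixed_diff_fwd_diff)
    have "0 \<le> real i *\<^sub>R ?d" using v by (intro scaleR_nonneg_nonneg) auto
    thus "lo \<le> x + real i *\<^sub>R ?d" using Cons.prems(3) by (simp add: add_increasing2)
    have "real i *\<^sub>R ?d \<le> 1 *\<^sub>R v"
      unfolding scaleR_scaleR using i v by (intro scaleR_right_mono) (auto simp: field_simps)
    hence "x + real i *\<^sub>R ?d + sum_list vs \<le> x + v + sum_list vs" by simp
    also have "\<dots> \<le> hi" using Cons.prems(4) by (simp add: add.assoc)
    finally show "x + real i *\<^sub>R ?d + sum_list vs \<le> hi" .
  qed (use Cons.prems in auto)
  hence "(\<Sum>i<M. - (real M ^ length vs * e)) \<le> (\<Sum>i<M. mixed_diff vs (fwd_diff ?d g) (x + real i *\<^sub>R ?d))"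
    by (intro sum_mono) auto
  also have "\<dots> = (\<Sum>i<M. mixed_diff vs g (x + real (Suc i) *\<^sub>R ?d) - mixed_diff vs g (x + real i *\<^sub>R ?d))"
  proof -
    have "x + real (Suc i) *\<^sub>R d = x + real i *\<^sub>R d + d" for i and d :: 'a
      by (simp add: scaleR_add_left algebra_simps)
    thus ?thesis unfolding mixed_diff_fwd_diff fwd_diff_def by (simp only:)
  qed
  also have "\<dots> = mixed_diff vs g (x + real M *\<^sub>R ?d) - mixed_diff vs g (x + real 0 *\<^sub>R ?d)"
    by (rule sum_lessThan_telescope)
  also have "\<dots> = mixed_diff (v # vs) g x" using \<open>0 < M\<close> by (simp add: fwd_diff_def)
  finally show ?case by simp
qed simp

text \<open>
  Two scales are used. The coarse steps are \<open>v / M\<close>, which keeps the averaging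
  window within the modulus of continuity of \<open>f\<close>; for fixed \<open>M\<close> the
  fine steps \<open>v / (M L)\<close> with \<open>L \<rightarrow> \<infinity>\<close> make the
  error of the lower bound vanish even after multiplication by the number of cells. The slack
  \<open>\<eta>\<close> leaves room for the window beyond the far corner.
\<close>
theorem mixed_diff_nonneg_of_hankel_positive:
  fixes f :: "'a::ordered_euclidean_space \<Rightarrow> real"
  assumes pos: "hankel_positive f lo hi" and cont: "continuous_on {lo..hi} f"
    and vs: "\<forall>v\<in>set vs. 0 \<le> v" and x: "lo \<le> x" and "0 < \<eta>" "x + (1 + \<eta>) *\<^sub>R sum_list vs \<le> hi"
  shows "0 \<le> mixed_diff vs f x"
proof -
  let ?S = "sum_list vs" and ?n = "length vs"
  have S0: "0 \<le> ?S" using vs by (intro sum_list_nonneg) auto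
  have xS: "x + ?S \<le> hi"
  proof -
    have "1 *\<^sub>R ?S \<le> (1 + \<eta>) *\<^sub>R ?S" using S0 \<open>0 < \<eta>\<close> by (intro scaleR_right_mono) auto
    thus ?thesis using assms(6) by (metis add_left_mono order_trans scaleR_one)
  qed
  have comp: "compact {lo..hi}" by (simp add: cbox_interval[symmetric])
  hence "bounded (f ` {lo..hi})" using compact_continuous_image cont compact_imp_bounded by blast
  then obtain C where "\<And>z. z \<in> {lo..hi} \<Longrightarrow> \<bar>f z\<bar> \<le> C" "0 \<le> C"
    unfolding bounded_pos by fastforce
  hence C: "\<And>z. lo \<le> z \<Longrightarrow> z \<le> hi \<Longrightarrow> \<bar>f z\<bar> \<le> C" "0 \<le> C" by auto
  obtain k D where D: "0 \<le> D"
    and low: "\<forall>hs L y. length hs = ?n \<longrightarrow> (\<forall>h\<in>set hs. 0 \<le> h) \<longrightarrow> 0 < L \<longrightarrow> lo \<le> y \<longrightarrow>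
     y + real (2 * Suc k) *\<^sub>R sum_list hs \<le> hi \<longrightarrow>
     - (D / real L) \<le> mixed_diff hs (smoothing L k (map (\<lambda>h. (1 / real L) *\<^sub>R h) hs) f) y"
    using smoothed_mixed_diff_lower_bound[OF pos C, of ?n] by blast
  have main: "- (2 ^ ?n * e) \<le> mixed_diff vs f x" if e: "0 < e" for e
  proof -
    have "uniformly_continuous_on {lo..hi} f" by (rule compact_uniformly_continuous[OF cont comp])
    then obtain \<delta> where \<delta>: "0 < \<delta>"
      "\<And>y z. y \<in> {lo..hi} \<Longrightarrow> z \<in> {lo..hi} \<Longrightarrow> dist z y < \<delta> \<Longrightarrow> dist (f z) (f y) < e"
      using e unfolding uniformly_continuous_on_def by blast
    obtain M1 :: nat where M1: "real (2 * Suc k) / \<eta> < real M1" using reals_Archimedean2 by blast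
    obtain M2 :: nat where M2: "real k * norm ?S / \<delta> < real M2" using reals_Archimedean2 by blast
    define M where "M = Suc (max M1 M2)"
    \<comment> \<open>the first bound keeps all points below \<open>hi\<close>, the second keeps the averaging window within \<open>\<delta>\<close>\<close>
    have M: "0 < M" "real (2 * Suc k) / real M \<le> \<eta>" "real k / real M * norm ?S < \<delta>"
    proof -
      show "0 < M" by (simp add: M_def)
      have "real (2 * Suc k) / \<eta> \<le> real M" using M1 by (simp add: M_def del: of_nat_mult)
      thus "real (2 * Suc k) / real M \<le> \<eta>" using \<open>0 < \<eta>\<close> \<open>0 < M\<close> by (simp add: field_simps)
      have "real k * norm ?S / \<delta> < real M" using M2 by (simp add: M_def)
      thus "real k / real M * norm ?S < \<delta>" using \<open>0 < \<delta>\<close> \<open>0 < M\<close> by (simp add: field_simps)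
    qed
    define hs where "hs = map (\<lambda>v. (1 / real M) *\<^sub>R v) vs"
    have hs: "length hs = ?n" "\<forall>h\<in>set hs. 0 \<le> h" using vs by (auto simp: hs_def scaleR_nonneg_nonneg)
    have sum_hs: "sum_list hs = (1 / real M) *\<^sub>R ?S"
      unfolding hs_def by (induction vs) (simp_all add: scaleR_add_right)
    have est: "- (2 ^ ?n * e) - (real M ^ ?n * D) / real L \<le> mixed_diff vs f x" if L: "0 < L" for L
    proof -
      define us where "us = map (\<lambda>h. (1 / real L) *\<^sub>R h) hs"
      have us: "\<forall>u\<in>set us. 0 \<le> u" using hs by (auto simp: us_def scaleR_nonneg_nonneg)
      have sum_us: "sum_list us = (1 / real L) *\<^sub>R sum_list hs"
        unfolding us_def by (induction hs) (simp_all add: scaleR_add_right)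
      define g where "g = smoothing L k us f"
      have room: "y + real (2 * Suc k) *\<^sub>R sum_list hs \<le> hi" if "y \<le> x + ?S" for y
      proof -
        have "real (2 * Suc k) *\<^sub>R sum_list hs = (real (2 * Suc k) / real M) *\<^sub>R ?S" by (simp add: sum_hs)
        also have "\<dots> \<le> \<eta> *\<^sub>R ?S" by (rule scaleR_right_mono[OF M(2) S0])
        finally have "y + real (2 * Suc k) *\<^sub>R sum_list hs \<le> (x + ?S) + \<eta> *\<^sub>R ?S" using that by (rule add_mono[rotated])
        also have "\<dots> \<le> hi" using assms(6) by (simp add: algebra_simps)
        finally show ?thesis .
      qed
      have "- (real M ^ ?n * (D / real L)) \<le> mixed_diff vs g x"
      proof (rule mixed_diff_subdivide_lower[of M _ vs lo "x + ?S"])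
        fix y assume "lo \<le> y" "y \<le> x + ?S"
        thus "- (D / real L) \<le> mixed_diff (map (\<lambda>v. (1 / real M) *\<^sub>R v) vs) g y"
          using low[rule_format, of hs L y] hs L room[of y] unfolding hs_def[symmetric] g_def us_def by simp
      qed (use M D vs x in auto)
      moreover have "\<bar>mixed_diff vs (\<lambda>z. g z - f z) x\<bar> \<le> 2 ^ ?n * e"
      proof (rule mixed_diff_bound[of x "x + ?S"])
        fix z assume z: "x \<le> z" "z \<le> x + ?S"
        let ?w = "real k *\<^sub>R sum_list hs"
        have w: "0 \<le> ?w" using S0 by (simp add: sum_hs scaleR_nonneg_nonneg)
        have "?w \<le> real (2 * Suc k) *\<^sub>R sum_list hs"
          unfolding sum_hs scaleR_scaleR using S0 by (intro scaleR_right_mono) (auto simp: divide_right_mono)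
        hence zw: "z + ?w \<le> hi" using room[OF z(2)] by (metis add_left_mono order_trans)
        have lz: "lo \<le> z" using x z(1) by (rule order_trans)
        have "g z \<in> {f z - e..f z + e}"
          unfolding g_def
        proof (rule smoothing_in_convex[of _ z "z + ?w"])
          fix s assume s: "z \<le> s" "s \<le> z + ?w"
          have "norm (s - z) \<le> norm ?w"
          proof (rule norm_le_componentwise)
            fix b :: 'a assume b: "b \<in> Basis"
            from s have "0 \<le> s - z" "s - z \<le> ?w" by (auto simp: algebra_simps)
            with b have "inner 0 b \<le> inner (s - z) b" "inner (s - z) b \<le> inner ?w b"
              using eucl_le[of 0 "s - z"] eucl_le[of "s - z" ?w] by blast+
            thus "\<bar>inner (s - z) b\<bar> \<le> \<bar>inner ?w b\<bar>" by simp
          qed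
          also have "norm ?w = real k / real M * norm ?S" by (simp add: sum_hs)
          finally have "dist s z < \<delta>" using M(3) by (simp add: dist_norm)
          moreover have "s \<in> {lo..hi}" "z \<in> {lo..hi}" using s zw lz w by (auto intro: order_trans)
          ultimately have "dist (f s) (f z) < e" by (intro \<delta>(2))
          thus "f s \<in> {f z - e..f z + e}" by (auto simp: dist_real_def)
        next
          show "z \<le> z + ?w - (real k * real L) *\<^sub>R sum_list us" using L by (simp add: sum_us)
        qed (use us L in auto)
        thus "\<bar>g z - f z\<bar> \<le> e" by auto
      qed (use vs in auto)
      ultimately show ?thesis by (simp add: mixed_diff_diff)
    qed
    have "(\<lambda>L. - (2 ^ ?n * e) - (real M ^ ?n * D) * (1 / real L)) \<longlonglongrightarrow> - (2 ^ ?n * e) - (real M ^ ?n * D) * 0"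
      by (intro tendsto_intros lim_inverse_n')
    hence "- (2 ^ ?n * e) - (real M ^ ?n * D) * 0 \<le> mixed_diff vs f x"
      by (rule tendsto_upperbound) (use est in \<open>auto intro!: eventually_sequentiallyI[of 1]\<close>)
    thus ?thesis by simp
  qed
  have "0 \<le> mixed_diff vs f x + e" if "0 < e" for e
    using main[of "e / 2 ^ ?n"] that by simp
  thus ?thesis by (rule field_le_epsilon)
qed

section \<open>Positive semidefinite arrays\<close>

definition psd :: "nat \<Rightarrow> (nat \<Rightarrow> nat \<Rightarrow> real) \<Rightarrow> bool" where
  "psd N a \<longleftrightarrow> (\<forall>i<N. \<forall>j<N. a i j = a j i) \<and> (\<forall>c. 0 \<le> (\<Sum>i<N. \<Sum>j<N. c i * c j * a i j))"

lemma psdD: "psd N a \<Longrightarrow> 0 \<le> (\<Sum>i<N. \<Sum>j<N. c i * c j * a i j)"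
  by (simp add: psd_def)

lemma psd_cong:
  "(\<And>i j. i < N \<Longrightarrow> j < N \<Longrightarrow> a i j = b i j) \<Longrightarrow> psd N a = psd N b"
  by (simp add: psd_def)

lemma positive_mat_iff_psd:
  assumes A: "A \<in> carrier_mat N N"
  shows "positive_mat A \<longleftrightarrow> psd N (\<lambda>i j. A $$ (i, j))"
proof -
  have sym: "transpose_mat A = A \<longleftrightarrow> (\<forall>i<N. \<forall>j<N. A $$ (i, j) = A $$ (j, i))"
  proof
    assume "transpose_mat A = A"
    thus "\<forall>i<N. \<forall>j<N. A $$ (i, j) = A $$ (j, i)"
      using A by (metis carrier_matD index_transpose_mat(1))
  next
    assume "\<forall>i<N. \<forall>j<N. A $$ (i, j) = A $$ (j, i)"
    thus "transpose_mat A = A" using A by (intro eq_matI) auto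
  qed
  have form: "scalar_prod v (A *\<^sub>v v) = (\<Sum>i<N. \<Sum>j<N. vec_index v i * vec_index v j * A $$ (i, j))"
    if "v \<in> carrier_vec N" for v
    using A that by (auto simp: scalar_prod_def lessThan_atLeast0 sum_distrib_left mult_ac intro!: sum.cong)
  have "(\<forall>v\<in>carrier_vec N. 0 \<le> scalar_prod v (A *\<^sub>v v)) \<longleftrightarrow>
      (\<forall>c. 0 \<le> (\<Sum>i<N. \<Sum>j<N. c i * c j * A $$ (i, j)))"
  proof (intro iffI allI ballI)
    fix c :: "nat \<Rightarrow> real"
    assume "\<forall>v\<in>carrier_vec N. 0 \<le> scalar_prod v (A *\<^sub>v v)"
    hence "0 \<le> scalar_prod (Matrix.vec N c) (A *\<^sub>v Matrix.vec N c)" by simp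
    thus "0 \<le> (\<Sum>i<N. \<Sum>j<N. c i * c j * A $$ (i, j))" by (simp add: form)
  next
    fix v :: "real Matrix.vec" assume "v \<in> carrier_vec N" "\<forall>c. 0 \<le> (\<Sum>i<N. \<Sum>j<N. c i * c j * A $$ (i, j))"
    thus "0 \<le> scalar_prod v (A *\<^sub>v v)" by (simp add: form)
  qed
  thus ?thesis using A sym by (simp add: positive_mat_def psd_def)
qed

lemma quadratic_form_Suc:
  fixes a :: "nat \<Rightarrow> nat \<Rightarrow> real"
  assumes "\<And>i. i < N \<Longrightarrow> a N i = a i N"
  shows "(\<Sum>i<Suc N. \<Sum>j<Suc N. c i * c j * a i j) =
     (\<Sum>i<N. \<Sum>j<N. c i * c j * a i j) + 2 * c N * (\<Sum>i<N. c i * a i N) + (c N)\<^sup>2 * a N N"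
proof -
  have "(\<Sum>i<N. c N * c i * a N i) = c N * (\<Sum>i<N. c i * a i N)"
    using assms by (simp add: sum_distrib_left mult_ac)
  moreover have "(\<Sum>i<N. c i * c N * a i N) = c N * (\<Sum>i<N. c i * a i N)"
    by (simp add: sum_distrib_left mult_ac)
  ultimately show ?thesis by (simp add: sum.distrib power2_eq_square)
qed

text \<open>
  Elimination of the last index: subtracting the rank-one array of the last column, scaled by
  its diagonal entry, leaves a positive semidefinite array on the remaining indices. If the
  diagonal entry is zero, then the last column vanishes, and the convention \<open>x / 0 =
  0\<close> makes the same formula correct.
\<close>
lemma psd_gram:
  assumes "psd N a"
  shows "\<exists>w. \<forall>i<N. \<forall>j<N. a i j = (\<Sum>l<N. w l i * w l j)"
  using assms
proof (induction N arbitrary: a)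
  case (Suc N)
  have sym: "\<And>i j. i < Suc N \<Longrightarrow> j < Suc N \<Longrightarrow> a i j = a j i"
    and pos: "\<And>c. 0 \<le> (\<Sum>i<Suc N. \<Sum>j<Suc N. c i * c j * a i j)"
    using Suc.prems unfolding psd_def by blast+
  have form: "0 \<le> (\<Sum>i<N. \<Sum>j<N. c i * c j * a i j) + 2 * s * (\<Sum>i<N. c i * a i N) + s\<^sup>2 * a N N" for c s
  proof -
    let ?c = "c(N := s)"
    have "(\<Sum>i<N. \<Sum>j<N. ?c i * ?c j * a i j) = (\<Sum>i<N. \<Sum>j<N. c i * c j * a i j)"
      "(\<Sum>i<N. ?c i * a i N) = (\<Sum>i<N. c i * a i N)"
      by (intro sum.cong refl; simp)+
    thus ?thesis using pos[of ?c] quadratic_form_Suc[of N a ?c] sym by simp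
  qed
  have d: "0 \<le> a N N" using form[of "\<lambda>_. 0" 1] by simp
  have zero: "a i N = 0" if "a N N = 0" "i < N" for i
  proof (rule ccontr)
    assume n: "a i N \<noteq> 0"
    let ?c = "\<lambda>k. if k = i then 1 else 0 :: real"
    have "(\<Sum>k<N. \<Sum>l<N. ?c k * ?c l * a k l) = (\<Sum>k<N. if k = i then a i i else 0)"
      using that by (intro sum.cong refl) (simp add: if_distrib[of "\<lambda>x. x * _"] cong: if_cong)
    also have "\<dots> = a i i" using that by simp
    finally have "(\<Sum>k<N. \<Sum>l<N. ?c k * ?c l * a k l) = a i i" .
    moreover have "(\<Sum>k<N. ?c k * a k N) = a i N"
      using that by (simp add: if_distrib[of "\<lambda>x. x * _"] cong: if_cong)
    ultimately have "0 \<le> a i i + 2 * s * a i N" for s using form[of ?c s] that by simp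
    from this[of "- (a i i + 1) / (2 * a i N)"] n show False by (simp add: field_simps)
  qed
  define u where "u i = a i N / sqrt (a N N)" for i
  have "psd N (\<lambda>i j. a i j - u i * u j)"
    unfolding psd_def
  proof (intro conjI allI impI)
    fix i j assume "i < N" "j < N" thus "a i j - u i * u j = a j i - u j * u i" using sym[of i j] by simp
  next
    fix c :: "nat \<Rightarrow> real"
    let ?b = "\<Sum>i<N. c i * a i N"
    have "(\<Sum>i<N. \<Sum>j<N. c i * c j * (u i * u j)) = (\<Sum>i<N. c i * u i)\<^sup>2"
      by (simp add: power2_eq_square sum_product mult_ac)
    also have "(\<Sum>i<N. c i * u i) = ?b / sqrt (a N N)" by (simp add: u_def sum_divide_distrib)
    also have "(?b / sqrt (a N N))\<^sup>2 = ?b\<^sup>2 / a N N" using d by (simp add: power_divide)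
    finally have "(\<Sum>i<N. \<Sum>j<N. c i * c j * (a i j - u i * u j)) =
        (\<Sum>i<N. \<Sum>j<N. c i * c j * a i j) - ?b\<^sup>2 / a N N"
      by (simp add: right_diff_distrib sum_subtractf)
    \<comment> \<open>minimise the quadratic in the last coordinate\<close>
    also have "\<dots> = (\<Sum>i<N. \<Sum>j<N. c i * c j * a i j) + 2 * (- ?b / a N N) * ?b + (- ?b / a N N)\<^sup>2 * a N N"
      by (cases "a N N = 0") (simp_all add: field_simps power2_eq_square)
    also have "\<dots> \<ge> 0" by (rule form)
    finally show "0 \<le> (\<Sum>i<N. \<Sum>j<N. c i * c j * (a i j - u i * u j))" .
  qed
  then obtain w where w: "\<And>i j. i < N \<Longrightarrow> j < N \<Longrightarrow> a i j - u i * u j = (\<Sum>l<N. w l i * w l j)"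
    using Suc.IH by blast
  let ?w = "\<lambda>l i. if l = N then u i else if i = N then 0 else w l i"
  have uN: "a i N = u i * u N" if "i < Suc N" for i
    using zero[of i] that d by (cases "a N N = 0") (auto simp: u_def less_Suc_eq)
  have "a i j = (\<Sum>l<Suc N. ?w l i * ?w l j)" if "i < Suc N" "j < Suc N" for i j
  proof (cases "i = N \<or> j = N")
    case True
    hence "(\<Sum>l<N. ?w l i * ?w l j) = 0" by (intro sum.neutral) auto
    moreover have "a i j = u i * u j" using True uN[of i] uN[of j] sym[of i j] that by (auto simp: mult.commute)
    ultimately show ?thesis by simp
  next
    case False
    hence "(\<Sum>l<N. ?w l i * ?w l j) = (\<Sum>l<N. w l i * w l j)" by (intro sum.cong refl) auto
    thus ?thesis using w[of i j] False that by (simp add: algebra_simps less_Suc_eq)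
  qed
  thus ?case by (intro exI[of _ ?w]) blast
qed simp

text \<open>
  The Schur product theorem: with a Gram representation of the first factor, the form of the
  product is a sum of forms of the second factor.
\<close>
lemma psd_mult:
  assumes "psd N a" "psd N b"
  shows "psd N (\<lambda>i j. a i j * b i j)"
proof -
  obtain w where w: "\<And>i j. i < N \<Longrightarrow> j < N \<Longrightarrow> a i j = (\<Sum>l<N. w l i * w l j)"
    using psd_gram[OF assms(1)] by blast
  have "0 \<le> (\<Sum>i<N. \<Sum>j<N. c i * c j * (a i j * b i j))" for c
  proof -
    have "(\<Sum>i<N. \<Sum>j<N. c i * c j * (a i j * b i j))
        = (\<Sum>i<N. \<Sum>j<N. \<Sum>l<N. (c i * w l i) * (c j * w l j) * b i j)"
      by (intro sum.cong refl) (simp add: w sum_distrib_left sum_distrib_right mult_ac)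
    also have "\<dots> = (\<Sum>i<N. \<Sum>l<N. \<Sum>j<N. (c i * w l i) * (c j * w l j) * b i j)"
      by (intro sum.cong refl sum.swap)
    also have "\<dots> = (\<Sum>l<N. \<Sum>i<N. \<Sum>j<N. (c i * w l i) * (c j * w l j) * b i j)"
      by (rule sum.swap)
    also have "\<dots> \<ge> 0"
    proof (rule sum_nonneg)
      fix l
      show "0 \<le> (\<Sum>i<N. \<Sum>j<N. (c i * w l i) * (c j * w l j) * b i j)"
        using assms(2)[unfolded psd_def, THEN conjunct2, rule_format, of "\<lambda>i. c i * w l i"] .
    qed
    finally show ?thesis .
  qed
  thus ?thesis using assms by (auto simp: psd_def)
qed

lemma psd_const: "0 \<le> c \<Longrightarrow> psd N (\<lambda>_ _. c)"
proof -
  assume "0 \<le> c"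
  moreover have "(\<Sum>i<N. \<Sum>j<N. e i * e j * c) = c * (\<Sum>i<N. e i)\<^sup>2" for e
    by (simp add: power2_eq_square sum_product sum_distrib_left mult_ac)
  ultimately show ?thesis by (simp add: psd_def)
qed

lemma psd_rank_one: "psd N (\<lambda>i j. u i * u j)"
proof -
  have "(\<Sum>i<N. \<Sum>j<N. e i * e j * (u i * u j)) = (\<Sum>i<N. e i * u i)\<^sup>2" for e
    by (simp add: power2_eq_square sum_product mult_ac)
  thus ?thesis by (simp add: psd_def mult.commute)
qed

lemma psd_add: "psd N a \<Longrightarrow> psd N b \<Longrightarrow> psd N (\<lambda>i j. a i j + b i j)"
  by (simp add: psd_def distrib_left sum.distrib)

lemma psd_sum: "(\<And>k. k \<in> K \<Longrightarrow> psd N (a k)) \<Longrightarrow> psd N (\<lambda>i j. \<Sum>k\<in>K. a k i j)"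
  by (induction K rule: infinite_finite_induct) (simp_all add: psd_const psd_add)

lemma psd_power: "psd N a \<Longrightarrow> psd N (\<lambda>i j. a i j ^ k)"
  by (induction k) (simp_all add: psd_const psd_mult)

lemma psd_limit:
  assumes lim: "\<And>i j. i < N \<Longrightarrow> j < N \<Longrightarrow> (\<lambda>n. a n i j) \<longlonglongrightarrow> b i j"
    and psd: "\<And>n. psd N (a n)"
  shows "psd N b"
  unfolding psd_def
proof (intro conjI allI impI)
  fix i j assume "i < N" "j < N"
  moreover from this have "(\<lambda>n. a n i j) = (\<lambda>n. a n j i)" using psd by (auto simp: psd_def)
  ultimately show "b i j = b j i" using lim[of i j] lim[of j i] LIMSEQ_unique by metis
next
  fix c :: "nat \<Rightarrow> real"
  have "(\<lambda>n. \<Sum>i<N. \<Sum>j<N. c i * c j * a n i j) \<longlonglongrightarrow> (\<Sum>i<N. \<Sum>j<N. c i * c j * b i j)"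
    by (intro tendsto_intros lim) auto
  thus "0 \<le> (\<Sum>i<N. \<Sum>j<N. c i * c j * b i j)"
    by (rule LIMSEQ_le_const) (use psd in \<open>auto simp: psd_def\<close>)
qed

section \<open>Preservation of positivity from non-negative differences\<close>

text \<open>
  Substituting Newton's formula for the values of \<open>F\<close> leaves sums of \<open>m
  choose j\<close> against the Bernstein weights, which are the factorial moments of a binomial
  distribution.
\<close>
lemma bernstein_sum_eq_differences:
  fixes F :: "'a::real_vector \<Rightarrow> real"
  shows "(\<Sum>m\<le>n. F (y + real m *\<^sub>R v) * Bernstein n m t) = (\<Sum>j\<le>n. real (n choose j) * t ^ j * (fwd_diff v ^^ j) F y)"
proof -
  let ?D = "\<lambda>j. (fwd_diff v ^^ j) F y"
  have inner: "(\<Sum>m\<in>{j..n}. real (m choose j) * Bernstein n m t) = real (n choose j) * t ^ j" if j: "j \<le> n" for j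
  proof -
    have "(\<Sum>m\<in>{j..n}. real (m choose j) * Bernstein n m t)
        = (\<Sum>i\<le>n - j. real ((i + j) choose j) * Bernstein n (i + j) t)"
      using j by (intro sum.reindex_bij_witness[of _ "\<lambda>i. i + j" "\<lambda>m. m - j"]) auto
    also have "\<dots> = (\<Sum>i\<le>n - j. (real (n choose j) * t ^ j) * Bernstein (n - j) i t)"
    proof (intro sum.cong refl)
      fix i assume "i \<in> {..n - j}"
      hence i: "i + j \<le> n" using j by auto
      have "(n choose (i + j)) * ((i + j) choose j) = (n choose j) * ((n - j) choose i)"
        using choose_mult[of j "i + j" n] i by simp
      hence "real (n choose (i + j)) * real ((i + j) choose j) = real (n choose j) * real ((n - j) choose i)"
        by (metis of_nat_mult)
      moreover have "n - (i + j) = n - j - i" by simp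
      ultimately show "real ((i + j) choose j) * Bernstein n (i + j) t = (real (n choose j) * t ^ j) * Bernstein (n - j) i t"
        by (simp add: Bernstein_def power_add mult_ac)
    qed
    also have "\<dots> = real (n choose j) * t ^ j"
      by (simp only: sum_distrib_left[symmetric] sum_Bernstein mult_1_right)
    finally show ?thesis .
  qed
  have "(\<Sum>m\<le>n. F (y + real m *\<^sub>R v) * Bernstein n m t)
      = (\<Sum>m\<le>n. \<Sum>j\<le>n. (real (m choose j) * Bernstein n m t) * ?D j)"
  proof (intro sum.cong refl)
    fix m assume "m \<in> {..n}"
    hence "F (y + real m *\<^sub>R v) = (\<Sum>j\<le>n. real (m choose j) * ?D j)"
      unfolding newton_forward[of F y m v] by (intro sum.mono_neutral_left) (auto simp: binomial_eq_0)
    thus "F (y + real m *\<^sub>R v) * Bernstein n m t = (\<Sum>j\<le>n. (real (m choose j) * Bernstein n m t) * ?D j)"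
      by (simp add: sum_distrib_left mult_ac)
  qed
  also have "\<dots> = (\<Sum>j\<le>n. (\<Sum>m\<le>n. real (m choose j) * Bernstein n m t) * ?D j)"
    by (subst sum.swap) (simp add: sum_distrib_right)
  also have "\<dots> = (\<Sum>j\<le>n. (\<Sum>m\<in>{j..n}. real (m choose j) * Bernstein n m t) * ?D j)"
    by (intro sum.cong refl arg_cong2[where f = "(*)"] sum.mono_neutral_right) (auto simp: binomial_eq_0)
  also have "\<dots> = (\<Sum>j\<le>n. real (n choose j) * t ^ j * ?D j)"
    by (intro sum.cong refl) (simp add: inner)
  finally show ?thesis .
qed

lemmas le_vec_iff = Finite_Cartesian_Product.less_eq_vec_def
lemmas eq_vec_iff = Finite_Cartesian_Product.vec_eq_iff

text \<open>
  Zero steps are included so that the class is closed under \<open>clear_coord\<close>.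
\<close>
definition axis_step :: "real ^ 'm \<Rightarrow> bool" where
  "axis_step v \<longleftrightarrow> (\<exists>k t. 0 \<le> t \<and> v = t *\<^sub>R axis k 1)"

text \<open>
  The endpoint \<open>x + sum_list vs\<close> is the farthest corner. On the sets considered
  here, it and \<open>x\<close> being in \<open>S\<close> force all other corners to be in
  \<open>S\<close>.
\<close>
definition differences_nonneg_on :: "(real ^ 'm) set \<Rightarrow> (real ^ 'm \<Rightarrow> real) \<Rightarrow> bool" where
  "differences_nonneg_on S G \<longleftrightarrow>
     (\<forall>vs x. (\<forall>v\<in>set vs. axis_step v) \<longrightarrow> x \<in> S \<longrightarrow> x + sum_list vs \<in> S \<longrightarrow> 0 \<le> mixed_diff vs G x)"

definition clear_coord :: "'m \<Rightarrow> real ^ 'm \<Rightarrow> real ^ 'm" where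
  "clear_coord k x = (\<chi> l. if l = k then 0 else vec_nth x l)"

lemma clear_coord_add: "clear_coord k (x + y) = clear_coord k x + clear_coord k y"
  by (simp add: clear_coord_def eq_vec_iff)

lemma clear_coord_sum_list: "clear_coord k (sum_list vs) = sum_list (map (clear_coord k) vs)"
  by (induction vs) (simp_all add: clear_coord_add, simp add: clear_coord_def eq_vec_iff)

lemma axis_step_clear_coord: "axis_step v \<Longrightarrow> axis_step (clear_coord k v)"
proof -
  assume "axis_step v"
  then obtain l t where t: "0 \<le> t" "v = t *\<^sub>R axis l 1" by (auto simp: axis_step_def)
  hence "clear_coord k v = (if l = k then 0 else t) *\<^sub>R axis l 1"
    by (auto simp: clear_coord_def eq_vec_iff axis_def)
  thus ?thesis using t unfolding axis_step_def by (intro exI[of _ l] exI[of _ "if l = k then 0 else t"]) auto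
qed

lemma mixed_diff_comp_clear_coord:
  "mixed_diff vs (\<lambda>x. H (clear_coord k x)) x = mixed_diff (map (clear_coord k) vs) H (clear_coord k x)"
  by (induction vs arbitrary: x) (simp_all add: fwd_diff_def clear_coord_add)

lemma continuous_on_funpow_fwd_diff:
  fixes G :: "'a::real_normed_vector \<Rightarrow> real"
  assumes "continuous_on S G"
  shows "continuous_on {x. \<forall>i\<le>j. x + real i *\<^sub>R v \<in> S} ((fwd_diff v ^^ j) G)"
proof (induction j)
  case 0
  thus ?case using assms by simp
next
  case (Suc j)
  let ?T = "\<lambda>j. {x. \<forall>i\<le>j. x + real i *\<^sub>R v \<in> S}"
  have 1: "continuous_on (?T (Suc j)) ((fwd_diff v ^^ j) G)"
    by (rule continuous_on_subset[OF Suc]) auto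
  have "x + v + real i *\<^sub>R v \<in> S" if "x \<in> ?T (Suc j)" "i \<le> j" for x i
  proof -
    have "x + real (Suc i) *\<^sub>R v \<in> S" using that by blast
    thus ?thesis by (simp add: algebra_simps)
  qed
  hence "continuous_on (?T (Suc j)) (\<lambda>x. (fwd_diff v ^^ j) G (x + v))"
    by (intro continuous_on_compose2[OF Suc, of _ "\<lambda>x. x + v"] continuous_intros) auto
  with 1 have "continuous_on (?T (Suc j)) (\<lambda>x. (fwd_diff v ^^ j) G (x + v) - (fwd_diff v ^^ j) G x)"
    by (intro continuous_on_diff)
  moreover have "(fwd_diff v ^^ Suc j) G = (\<lambda>x. (fwd_diff v ^^ j) G (x + v) - (fwd_diff v ^^ j) G x)"
    by (rule ext) (rule funpow_fwd_diff_Suc)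
  ultimately show ?case by simp
qed

definition box_upto :: "real \<Rightarrow> (real ^ 'm) set" where
  "box_upto r = {x. \<forall>k. 0 \<le> vec_nth x k \<and> vec_nth x k \<le> r}"

text \<open>
  Induction on the set \<open>S\<close> of coordinates that are not frozen at zero. To release
  the coordinate \<open>k\<close>, approximate \<open>G\<close> in that coordinate by Bernstein
  polynomials: in Newton form the approximation is a sum of products of powers of \<open>a
  k\<close> with arrays of the differences \<open>\<Delta>\<^sup>qG\<close> at points whose
  coordinate \<open>k\<close> is zero, and the induction hypothesis covers those differences.
\<close>
lemma psd_of_differences_nonneg:
  fixes a :: "'m::finite \<Rightarrow> nat \<Rightarrow> nat \<Rightarrow> real" and G :: "real ^ 'm \<Rightarrow> real"
  assumes "0 < r" and psd: "\<And>k. psd N (a k)"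
    and range: "\<And>k i j. i < N \<Longrightarrow> j < N \<Longrightarrow> 0 \<le> a k i j \<and> a k i j \<le> r"
    and "finite S" and "continuous_on (box_upto r) G" "differences_nonneg_on (box_upto r) G"
  shows "psd N (\<lambda>i j. G (\<chi> k. if k \<in> S then a k i j else 0))"
  using assms(4-6)
proof (induction S arbitrary: G)
  case empty
  have "(0 :: real ^ 'm) \<in> box_upto r" using \<open>0 < r\<close> by (simp add: box_upto_def)
  hence "0 \<le> mixed_diff [] G 0" using empty.prems unfolding differences_nonneg_on_def by (metis empty_iff list.set(1) sum_list.Nil add_0_right)
  hence "0 \<le> G 0" by simp
  moreover have "(\<chi> k. (0 :: real)) = (0 :: real ^ 'm)" by (simp add: eq_vec_iff)
  ultimately show ?case by (simp add: psd_const)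
next
  case (insert k S)
  define Y where "Y i j = (\<chi> l. if l \<in> S then a l i j else (0 :: real))" for i j
  define e where "e = (axis k 1 :: real ^ 'm)"
  have X: "(\<chi> l. if l \<in> insert k S then a l i j else 0) = Y i j + a k i j *\<^sub>R e" for i j
    using insert.hyps by (auto simp: Y_def e_def axis_def eq_vec_iff)
  have Y_clear: "clear_coord k (Y i j) = Y i j" for i j
    using insert.hyps by (auto simp: Y_def clear_coord_def eq_vec_iff)
  have box_line: "clear_coord k y + s *\<^sub>R e \<in> box_upto r" if "y \<in> box_upto r" "0 \<le> s" "s \<le> r" for y s
    using that \<open>0 < r\<close> by (auto simp: box_upto_def clear_coord_def e_def axis_def)
  have Y_box: "Y i j \<in> box_upto r" if "i < N" "j < N" for i j
    using that range \<open>0 < r\<close> by (auto simp: Y_def box_upto_def)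
  define B where "B n i j = (\<Sum>q\<le>Suc n. real (Suc n choose q) * (a k i j / r) ^ q
      * (fwd_diff ((r / real (Suc n)) *\<^sub>R e) ^^ q) G (Y i j))" for n i j
  have B_psd: "psd N (B n)" for n
  proof -
    define v where "v = (r / real (Suc n)) *\<^sub>R e"
    have reach: "clear_coord k y + real i *\<^sub>R v \<in> box_upto r" if "y \<in> box_upto r" "i \<le> Suc n" for y i
    proof -
      have "real i * (r / real (Suc n)) \<le> r"
        using that(2) \<open>0 < r\<close> by (simp add: field_simps del: of_nat_Suc)
      thus ?thesis unfolding v_def scaleR_scaleR using that(1) \<open>0 < r\<close> by (intro box_line) auto
    qed
    have "psd N (\<lambda>i j. (fwd_diff v ^^ q) G (Y i j))" if q: "q \<le> Suc n" for q
    proof -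
      define H where "H x = (fwd_diff v ^^ q) G (clear_coord k x)" for x
      have "continuous_on (box_upto r) H"
        unfolding H_def
      proof (rule continuous_on_compose2[OF continuous_on_funpow_fwd_diff[OF insert.prems(1)]])
        show "continuous_on (box_upto r) (clear_coord k)"
        proof -
          have "continuous_on (box_upto r) (\<lambda>x. if l = k then 0 else vec_nth x l)" for l
            by (cases "l = k") (auto intro!: continuous_intros)
          thus ?thesis unfolding clear_coord_def by (rule continuous_on_vec_lambda)
        qed
        show "clear_coord k ` box_upto r \<subseteq> {x. \<forall>i\<le>q. x + real i *\<^sub>R v \<in> box_upto r}"
          using reach q by auto
      qed
      moreover have "differences_nonneg_on (box_upto r) H"
        unfolding differences_nonneg_on_def
      proof (intro allI impI)
        fix vs :: "(real ^ 'm) list" and x assume vs: "\<forall>v\<in>set vs. axis_step v"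
          and x: "x \<in> box_upto r" "x + sum_list vs \<in> box_upto r"
        let ?ws = "map (clear_coord k) vs @ replicate q v"
        have "mixed_diff vs H x = mixed_diff ?ws G (clear_coord k x)"
          unfolding H_def mixed_diff_comp_clear_coord mixed_diff_append mixed_diff_replicate ..
        also have "\<dots> \<ge> 0"
        proof -
          have "axis_step v" using \<open>0 < r\<close> unfolding axis_step_def v_def e_def
            by (intro exI[of _ k] exI[of _ "r / real (Suc n)"]) auto
          hence "\<forall>w\<in>set ?ws. axis_step w" using vs axis_step_clear_coord by auto
          moreover have "clear_coord k x \<in> box_upto r" using reach[OF x(1), of 0] by simp
          moreover have "sum_list (replicate q v) = real q *\<^sub>R v" by (induction q) (simp_all add: algebra_simps)
          hence "clear_coord k x + sum_list ?ws = clear_coord k (x + sum_list vs) + real q *\<^sub>R v"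
            by (simp add: clear_coord_add clear_coord_sum_list)
          hence "clear_coord k x + sum_list ?ws \<in> box_upto r" using reach[OF x(2) q] by simp
          ultimately show ?thesis using insert.prems(2) unfolding differences_nonneg_on_def by blast
        qed
        finally show "0 \<le> mixed_diff vs H x" .
      qed
      ultimately have "psd N (\<lambda>i j. H (Y i j))" unfolding Y_def by (rule insert.IH)
      thus ?thesis by (simp add: H_def Y_clear)
    qed
    moreover have "psd N (\<lambda>i j. (a k i j / r) ^ q)" for q
    proof -
      have "psd N (\<lambda>i j. (1 / r) * a k i j)" using \<open>0 < r\<close> by (intro psd_mult psd_const psd) simp
      thus ?thesis by (intro psd_power) simp
    qed
    ultimately show ?thesis unfolding B_def v_def by (intro psd_sum psd_mult psd_const) auto
  qed
  have B_lim: "(\<lambda>n. B n i j) \<longlonglongrightarrow> G (Y i j + a k i j *\<^sub>R e)" if ij: "i < N" "j < N" for i j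
  proof -
    define f where "f t = G (Y i j + (r * t) *\<^sub>R e)" for t
    have cont: "continuous_on {0..1} f"
      unfolding f_def
    proof (rule continuous_on_compose2[OF insert.prems(1)])
      show "(\<lambda>t. Y i j + (r * t) *\<^sub>R e) ` {0..1} \<subseteq> box_upto r"
        using box_line[OF Y_box[OF ij]] \<open>0 < r\<close> by (auto simp: Y_clear mult_left_le)
    qed (intro continuous_intros)
    have t: "a k i j / r \<in> {0..1}" using range[OF ij] \<open>0 < r\<close> by auto
    have "B n i j = (\<Sum>m\<le>Suc n. f (real m / real (Suc n)) * Bernstein (Suc n) m (a k i j / r))" for n
      unfolding B_def f_def bernstein_sum_eq_differences[symmetric] by (simp add: mult.commute)
    moreover have "(\<lambda>n. \<Sum>m\<le>Suc n. f (real m / real (Suc n)) * Bernstein (Suc n) m (a k i j / r)) \<longlonglongrightarrow> f (a k i j / r)"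
    proof (rule LIMSEQ_Suc, rule LIMSEQ_I)
      fix \<epsilon> :: real assume "0 < \<epsilon>"
      then obtain M where M: "\<And>n x. M \<le> n \<Longrightarrow> x \<in> {0..1} \<Longrightarrow>
          \<bar>f x - (\<Sum>m\<le>n. f (real m / real n) * Bernstein n m x)\<bar> < \<epsilon>"
        using Bernstein_Weierstrass[OF cont, of \<epsilon>] by blast
      show "\<exists>no. \<forall>n\<ge>no. norm ((\<Sum>m\<le>n. f (real m / real n) * Bernstein n m (a k i j / r)) - f (a k i j / r)) < \<epsilon>"
        using M[OF _ t] by (intro exI[of _ M]) (auto simp: abs_minus_commute)
    qed
    moreover have "f (a k i j / r) = G (Y i j + a k i j *\<^sub>R e)" using \<open>0 < r\<close> by (simp add: f_def)
    ultimately show ?thesis by simp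
  qed
  show ?case unfolding X by (rule psd_limit[OF B_lim B_psd])
qed

theorem preserves_positivity_of_differences_nonneg:
  fixes F :: "real ^ 'm \<Rightarrow> real"
  assumes "0 < \<rho>" and cont: "continuous_on (cube (dom_I \<rho>)) F"
    and diffs: "differences_nonneg_on (cube (dom_I \<rho>)) F"
  shows "preserves_positivity F (positive_mats (dom_I \<rho>))"
  unfolding preserves_positivity_def
proof (intro allI impI)
  fix N :: nat and A :: "'m \<Rightarrow> real mat"
  assume A: "\<forall>k. A k \<in> positive_mats (dom_I \<rho>) \<inter> carrier_mat N N"
  have entries: "A k $$ (i, j) \<in> dom_I \<rho>" if "i < N" "j < N" for k i j
  proof -
    have "A k \<in> positive_mats (dom_I \<rho>)" "A k \<in> carrier_mat N N" using A by auto
    thus ?thesis using that by (simp add: positive_mats_def)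
  qed
  obtain r0 where r0: "0 < r0" "ereal r0 < \<rho>" using \<open>0 < \<rho>\<close> by (metis ereal_dense2 ereal_less(2))
  define E where "E = insert r0 ((\<lambda>(k, i, j). A k $$ (i, j)) ` (UNIV \<times> {..<N} \<times> {..<N}))"
  define r where "r = Max E"
  have E: "finite E" "E \<noteq> {}" by (auto simp: E_def)
  have "E \<subseteq> dom_I \<rho>" using r0 entries by (auto simp: E_def dom_I_def)
  hence "r \<in> dom_I \<rho>" using Max_in[OF E] by (auto simp: r_def)
  hence r\<rho>: "ereal r < \<rho>" by (simp add: dom_I_def)
  have "r0 \<le> r" unfolding r_def by (rule Max_ge[OF E(1)]) (simp add: E_def)
  hence r: "0 < r" using r0 by simp
  have le_r: "A k $$ (i, j) \<le> r" if "i < N" "j < N" for k i j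
    unfolding r_def using that by (intro Max_ge[OF E(1)]) (auto simp: E_def image_iff)
  have sub: "box_upto r \<subseteq> (cube (dom_I \<rho>) :: (real ^ 'm) set)"
  proof
    fix x :: "real ^ 'm" assume "x \<in> box_upto r"
    thus "x \<in> cube (dom_I \<rho>)" using r\<rho> by (auto simp: box_upto_def cube_def dom_I_def intro: le_less_trans[of _ "ereal r"])
  qed
  have "psd N (\<lambda>i j. F (\<chi> k. if k \<in> UNIV then A k $$ (i, j) else 0))"
  proof (rule psd_of_differences_nonneg[OF r])
    show "psd N (\<lambda>i j. A k $$ (i, j))" for k
      using A positive_mat_iff_psd[of "A k" N] by (auto simp: positive_mats_def)
    show "0 \<le> A k $$ (i, j) \<and> A k $$ (i, j) \<le> r" if "i < N" "j < N" for k i j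
      using entries[OF that] le_r[OF that] by (auto simp: dom_I_def)
    show "continuous_on (box_upto r) F" by (rule continuous_on_subset[OF cont sub])
    show "differences_nonneg_on (box_upto r) F"
      using diffs sub unfolding differences_nonneg_on_def by blast
  qed simp
  hence "psd N (\<lambda>i j. entrywise N F A $$ (i, j))"
    by (subst psd_cong[of N _ "\<lambda>i j. F (\<chi> k. A k $$ (i, j))"]) (auto simp: entrywise_def)
  thus "positive_mat (entrywise N F A)"
    by (subst positive_mat_iff_psd[of _ N]) (auto simp: entrywise_def)
qed

section \<open>Functions that preserve positive Hankel matrices\<close>

lemma mem_cube_dom_I: "x \<in> cube (dom_I \<rho>) \<longleftrightarrow> (\<forall>k. 0 \<le> vec_nth x k \<and> ereal (vec_nth x k) < \<rho>)"
  by (simp add: cube_def dom_I_def)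

lemma cube_dom_I_interval:
  assumes "y \<in> cube (dom_I \<rho>)" "0 \<le> x" "x \<le> y"
  shows "x \<in> cube (dom_I \<rho>)"
  unfolding mem_cube_dom_I
proof
  fix k
  have "0 \<le> vec_nth x k" "ereal (vec_nth x k) \<le> ereal (vec_nth y k)"
    using assms by (auto simp: le_vec_iff)
  moreover have "ereal (vec_nth y k) < \<rho>" using assms by (simp add: mem_cube_dom_I)
  ultimately show "0 \<le> vec_nth x k \<and> ereal (vec_nth x k) < \<rho>" using le_less_trans by blast
qed

text \<open>
  The cube is open towards larger coordinates, so there is room to move in any non-negative
  direction.
\<close>
lemma cube_dom_I_room:
  fixes z w :: "real ^ 'm"
  assumes z: "z \<in> cube (dom_I \<rho>)" and w: "0 \<le> w"
  shows "\<exists>\<eta>>0. z + \<eta> *\<^sub>R w \<in> cube (dom_I \<rho>)"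
proof -
  define M where "M = Max (range (vec_nth z))"
  have fin: "finite (range (vec_nth z))" by simp
  have "M \<in> range (vec_nth z)" unfolding M_def by (rule Max_in) auto
  hence "ereal M < \<rho>" using z by (auto simp: mem_cube_dom_I)
  then obtain b where b: "M < b" "ereal b < \<rho>" by (metis ereal_dense2 ereal_less(2) less_ereal.simps(1))
  define \<eta> where "\<eta> = (b - M) / (1 + norm w)"
  have \<eta>: "0 < \<eta>" using b by (simp add: \<eta>_def add_pos_nonneg)
  have "0 \<le> vec_nth (z + \<eta> *\<^sub>R w) k \<and> ereal (vec_nth (z + \<eta> *\<^sub>R w) k) < \<rho>" for k
  proof -
    have wk: "0 \<le> vec_nth w k" using w by (simp add: le_vec_iff)
    have "vec_nth w k \<le> 1 + norm w" using component_le_norm_cart[of w k] by linarith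
    hence "\<eta> * vec_nth w k \<le> \<eta> * (1 + norm w)" using \<eta> by (intro mult_left_mono) auto
    also have "\<dots> = b - M" using norm_ge_zero[of w] by (simp add: \<eta>_def add_nonneg_eq_0_iff)
    finally have "\<eta> * vec_nth w k \<le> b - M" .
    moreover have "vec_nth z k \<le> M" unfolding M_def by (rule Max_ge[OF fin]) simp
    ultimately have "vec_nth z k + \<eta> * vec_nth w k \<le> b" by simp
    hence "ereal (vec_nth (z + \<eta> *\<^sub>R w) k) \<le> ereal b" by simp
    also have "\<dots> < \<rho>" by (rule b)
    finally show ?thesis using z wk \<eta> by (simp add: mem_cube_dom_I)
  qed
  thus ?thesis using \<eta> by (auto simp: mem_cube_dom_I)
qed

lemma psd_entrywise_of_hankel:
  fixes F :: "real ^ 'm \<Rightarrow> real" and s :: "'m \<Rightarrow> nat \<Rightarrow> real"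
  assumes pres: "preserves_positivity F (positive_hankel_mats I)" and "1 \<le> N"
    and psd: "\<And>k. psd N (\<lambda>i j. s k (i + j))"
    and range: "\<And>k n. n \<le> 2 * (N - 1) \<Longrightarrow> s k n \<in> I"
  shows "psd N (\<lambda>i j. F (\<chi> k. s k (i + j)))"
proof -
  define A where "A k = Matrix.mat N N (\<lambda>(i, j). s k (i + j))" for k
  have carr: "A k \<in> carrier_mat N N" for k by (simp add: A_def)
  have "positive_mat (A k)" for k
    unfolding positive_mat_iff_psd[OF carr] using psd[of k]
    by (subst psd_cong[of N _ "\<lambda>i j. s k (i + j)"]) (auto simp: A_def)
  moreover have "s k (i + j) \<in> I" if "i < N" "j < N" for k i j using that by (intro range) auto
  moreover have "hankel_mat (A k)" for k
    unfolding hankel_mat_def by (auto simp: A_def intro!: exI[of _ "s k"])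
  ultimately have "A k \<in> positive_hankel_mats I \<inter> carrier_mat N N" for k
    using carr[of k] by (auto simp: positive_hankel_mats_def positive_mats_def A_def)
  hence "positive_mat (entrywise N F A)"
    using pres \<open>1 \<le> N\<close> unfolding preserves_positivity_def by blast
  hence "psd N (\<lambda>i j. entrywise N F A $$ (i, j))"
    by (subst (asm) positive_mat_iff_psd[of _ N]) (auto simp: entrywise_def)
  thus ?thesis
    by (subst (asm) psd_cong[of N _ "\<lambda>i j. F (\<chi> k. s k (i + j))"]) (auto simp: entrywise_def A_def)
qed

context
  fixes \<rho> :: ereal and F :: "real ^ 'm \<Rightarrow> real"
  assumes pres: "preserves_positivity F (positive_hankel_mats (dom_I \<rho>))"
begin

lemma preserver_nonneg:
  assumes "x \<in> cube (dom_I \<rho>)"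
  shows "0 \<le> F x"
proof -
  have x: "0 \<le> vec_nth x k" "vec_nth x k \<in> dom_I \<rho>" for k
    using assms by (auto simp: cube_def dom_I_def)
  have "psd 1 (\<lambda>i j. F (\<chi> k. (\<lambda>_. vec_nth x k) (i + j)))"
    by (rule psd_entrywise_of_hankel[OF pres]) (use x in \<open>auto intro: psd_const\<close>)
  hence "0 \<le> (\<Sum>i<1::nat. \<Sum>j<1::nat. (1::real) * 1 * F x)"
    unfolding psd_def by (auto dest!: spec[of _ "\<lambda>_. 1"])
  thus ?thesis by simp
qed

text \<open>
  Every positive \<open>2 \<times> 2\<close> matrix is Hankel. For \<open>0 \<le> x \<le>
  y\<close> the one with diagonal \<open>y\<close> and off-diagonal entry \<open>x\<close> is
  positive; evaluate the form of its image at \<open>(1, -1)\<close>.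
\<close>
lemma preserver_mono:
  assumes "0 \<le> x" "x \<le> y" "y \<in> cube (dom_I \<rho>)"
  shows "F x \<le> F y"
proof -
  define s where "s k n = (if n = 1 then vec_nth x k else vec_nth y k)" for k and n :: nat
  have xy: "0 \<le> vec_nth x k" "vec_nth x k \<le> vec_nth y k" for k using assms by (auto simp: le_vec_iff)
  have x: "x \<in> cube (dom_I \<rho>)" using cube_dom_I_interval assms by blast
  have "psd 2 (\<lambda>i j. F (\<chi> k. s k (i + j)))"
  proof (rule psd_entrywise_of_hankel[OF pres])
    fix k
    have "(\<Sum>i<2. \<Sum>j<2. c i * c j * s k (i + j)) =
        vec_nth x k * (c 0 + c 1)\<^sup>2 + (vec_nth y k - vec_nth x k) * ((c 0)\<^sup>2 + (c 1)\<^sup>2)" for c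
      by (simp add: s_def numeral_2_eq_2 algebra_simps)
    thus "psd 2 (\<lambda>i j. s k (i + j))" using xy[of k] by (simp add: psd_def add.commute)
  next
    show "s k n \<in> dom_I \<rho>" for k n using x assms by (auto simp: s_def cube_def)
  qed simp
  hence "0 \<le> (\<Sum>i<2. \<Sum>j<2. (if i = 0 then 1 else -1) * (if j = 0 then 1 else -1) * F (\<chi> k. s k (i + j)))"
    by (rule psdD[where c = "\<lambda>i. if i = 0 then 1 else -1"])
  moreover have "(\<chi> k. s k 0) = y" "(\<chi> k. s k 1) = x" "(\<chi> k. s k 2) = y"
    by (simp_all add: s_def eq_vec_iff)
  ultimately show ?thesis by (simp add: numeral_2_eq_2)
qed

text \<open>
  The Hankel matrices of the geometric sequences \<open>a/t, a, t a\<close> have rank one, and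
  the image of a rank-one matrix has a non-negative determinant.
\<close>
lemma preserver_geometric:
  assumes t: "1 \<le> t" and a: "t *\<^sub>R a \<in> cube (dom_I \<rho>)"
  shows "(F a)\<^sup>2 \<le> F ((1 / t) *\<^sub>R a) * F (t *\<^sub>R a)"
proof -
  define s where "s k n = vec_nth a k / t * t ^ n" for k and n :: nat
  have a0: "0 \<le> vec_nth a k" for k
    using a t by (auto simp: mem_cube_dom_I zero_le_mult_iff)
  have "psd 2 (\<lambda>i j. F (\<chi> k. s k (i + j)))"
  proof (rule psd_entrywise_of_hankel[OF pres])
    fix k
    have "psd 2 (\<lambda>i j. vec_nth a k / t * (t ^ i * t ^ j))"
      using a0[of k] t by (intro psd_mult[OF psd_const psd_rank_one] psd_const) auto
    thus "psd 2 (\<lambda>i j. s k (i + j))" by (simp add: s_def power_add)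
  next
    fix k and n :: nat assume "n \<le> 2 * (2 - 1)"
    hence "t ^ n \<le> t ^ 2" using t by (intro power_increasing) auto
    hence "s k n \<le> vec_nth a k / t * t ^ 2"
      unfolding s_def using a0[of k] t by (intro mult_left_mono) auto
    also have "\<dots> = vec_nth (t *\<^sub>R a) k" using t by (simp add: power2_eq_square)
    finally have "ereal (s k n) \<le> ereal (vec_nth (t *\<^sub>R a) k)" by simp
    also have "\<dots> < \<rho>" using a by (simp add: mem_cube_dom_I)
    finally show "s k n \<in> dom_I \<rho>" using a0[of k] t by (auto simp: dom_I_def s_def)
  qed simp
  hence form: "0 \<le> (\<Sum>i<2. \<Sum>j<2. c i * c j * F (\<chi> k. s k (i + j)))" for c
    by (rule psdD)
  have s: "(\<chi> k. s k 0) = (1 / t) *\<^sub>R a" "(\<chi> k. s k 1) = a" "(\<chi> k. s k 2) = t *\<^sub>R a"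
    using t by (simp_all add: s_def eq_vec_iff power2_eq_square)
  let ?p = "F ((1 / t) *\<^sub>R a)" and ?q = "F a" and ?r = "F (t *\<^sub>R a)"
  \<comment> \<open>the form at \<open>(F(t a), - F a)\<close> is \<open>F(t a)\<close> times the determinant\<close>
  have "0 \<le> ?r\<^sup>2 * ?p - 2 * (?r * ?q * ?q) + ?q\<^sup>2 * ?r"
    using form[of "\<lambda>i. if i = 0 then ?r else - ?q"] s
    by (simp add: numeral_2_eq_2 algebra_simps)
  hence *: "0 \<le> ?r * (?p * ?r - ?q\<^sup>2)" by (simp add: algebra_simps power2_eq_square)
  have a': "0 \<le> a" using a0 by (simp add: le_vec_iff)
  have "a \<le> t *\<^sub>R a" using scaleR_right_mono[OF t a'] by simp
  hence "?q \<le> ?r" "0 \<le> ?q" "a \<in> cube (dom_I \<rho>)"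
    using preserver_mono[OF a' _ a] preserver_nonneg cube_dom_I_interval[OF a a'] by auto
  thus ?thesis using * by (cases "?r = 0") (auto simp: zero_le_mult_iff)
qed

text \<open>
  Let \<open>L\<close> be the limit of \<open>F\<close> along \<open>a + \<delta> 1\<close> as
  \<open>\<delta> \<rightarrow> 0\<close>, which exists by monotonicity. Apply \<open>F\<close>
  to the positive Hankel matrix \<open>a + \<delta> M\<close>, where \<open>M\<close> has the
  rows \<open>(1,0,1)\<close>, \<open>(0,1,1)\<close>, \<open>(1,1,2)\<close>, and let
  \<open>\<delta> \<rightarrow> 0\<close>. The limit has the entry \<open>F a\<close> where
  \<open>M\<close> is zero and \<open>L\<close> elsewhere, so its last two rows differ only in
  the first entry. Its form vanishes at \<open>(0, 1, -1)\<close>, so this vector is in the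
  kernel, whence \<open>F a = L\<close>; the form at \<open>(t, 1, -1)\<close> exhibits this.
  The entry zero of \<open>M\<close> is what makes the value at \<open>a\<close> itself, rather
  than a value beyond it, enter.
\<close>
lemma preserver_right_continuous:
  assumes a: "a \<in> cube (dom_I \<rho>)" and "0 < e"
  shows "\<exists>\<delta>>0. a + \<delta> *\<^sub>R 1 \<in> cube (dom_I \<rho>) \<and> F (a + \<delta> *\<^sub>R 1) < F a + e"
proof -
  have one: "(0 :: real ^ 'm) \<le> 1" by (simp add: le_vec_iff)
  have a0: "0 \<le> a" using a by (simp add: le_vec_iff mem_cube_dom_I)
  obtain \<delta>0 where \<delta>0: "0 < \<delta>0" "a + \<delta>0 *\<^sub>R 1 \<in> cube (dom_I \<rho>)"
    using cube_dom_I_room[OF a one] by blast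
  have between: "0 \<le> a + d *\<^sub>R 1 \<and> a + d *\<^sub>R 1 \<le> a + d' *\<^sub>R 1" if "0 \<le> d" "d \<le> d'" for d d' :: real
    using that a0 by (auto simp: le_vec_iff)
  have inside: "a + d *\<^sub>R 1 \<in> cube (dom_I \<rho>)" if "0 \<le> d" "d \<le> \<delta>0" for d
    using cube_dom_I_interval[OF \<delta>0(2)] between[OF that] by blast
  define g where "g n = F (a + (\<delta>0 / 2 ^ n) *\<^sub>R 1)" for n :: nat
  have le\<delta>0: "\<delta>0 / 2 ^ n \<le> \<delta>0" for n :: nat using \<delta>0 by (simp add: field_simps)
  have dec: "decseq g"
    unfolding decseq_Suc_iff
  proof
    fix n
    have d: "0 \<le> \<delta>0 / 2 ^ Suc n" "0 \<le> \<delta>0 / 2 ^ n" "\<delta>0 / 2 ^ Suc n \<le> \<delta>0 / 2 ^ n"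
      using \<delta>0 by (auto simp: field_simps)
    show "g (Suc n) \<le> g n"
      unfolding g_def using between[OF d(1,3)] inside[OF d(2) le\<delta>0] by (intro preserver_mono) auto
  qed
  have "F a \<le> g n" for n
    unfolding g_def using \<delta>0 a0 inside[OF _ le\<delta>0] by (intro preserver_mono) (auto simp: le_vec_iff)
  then obtain L where L: "g \<longlonglongrightarrow> L" "\<And>n. L \<le> g n" using decseq_convergent[OF dec] by blast
  have key: "0 \<le> t\<^sup>2 * g (Suc n) - 2 * t * (g (Suc n) - F a) + (g n - g (Suc n))" for t n
  proof -
    define \<delta> where "\<delta> = \<delta>0 / 2 ^ Suc n"
    have \<delta>: "0 < \<delta>" "2 * \<delta> = \<delta>0 / 2 ^ n" using \<delta>0 by (auto simp: \<delta>_def)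
    \<comment> \<open>the matrix \<open>(h (i + j))\<close> is the sum of the rank-one matrices of \<open>p = (1,0,1)\<close> and \<open>q = (0,1,1)\<close>\<close>
    define h :: "nat \<Rightarrow> real" where "h m = (if m = 1 then 0 else if m = 4 then 2 else 1)" for m
    define p q :: "nat \<Rightarrow> real" where "p i = (if i = 1 then 0 else 1)" and "q i = (if i = 0 then 0 else 1)" for i
    have h: "h (i + j) = p i * p j + q i * q j" if "i < 3" "j < 3" for i j
      using that by (auto simp: h_def p_def q_def less_Suc_eq numeral_3_eq_3)
    have "psd 3 (\<lambda>i j. F (\<chi> k. (\<lambda>m. vec_nth a k + \<delta> * h m) (i + j)))"
    proof (rule psd_entrywise_of_hankel[OF pres])
      fix k
      have "psd 3 (\<lambda>i j. vec_nth a k + \<delta> * (p i * p j + q i * q j))"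
        using a \<delta> by (intro psd_add psd_mult[OF psd_const psd_add[OF psd_rank_one psd_rank_one]] psd_const) (auto simp: mem_cube_dom_I)
      thus "psd 3 (\<lambda>i j. vec_nth a k + \<delta> * h (i + j))"
        by (subst psd_cong[of 3 _ "\<lambda>i j. vec_nth a k + \<delta> * (p i * p j + q i * q j)"]) (simp_all add: h)
    next
      fix k m
      have "\<delta> * h m \<le> \<delta>0" "0 \<le> \<delta> * h m" using \<delta> le\<delta>0[of n] by (auto simp: h_def)
      from inside[OF this(2,1)] show "vec_nth a k + \<delta> * h m \<in> dom_I \<rho>" by (simp add: cube_def)
    qed simp
    hence "0 \<le> (\<Sum>i<3. \<Sum>j<3. (if i = 0 then t else if i = 1 then 1 else -1) * (if j = 0 then t else if j = 1 then 1 else -1)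
        * F (\<chi> k. vec_nth a k + \<delta> * h (i + j)))"
      by (rule psdD[where c = "\<lambda>i. if i = 0 then t else if i = 1 then 1 else -1"])
    moreover have "(\<chi> k. vec_nth a k + d) = a + d *\<^sub>R 1" for d
      by (simp add: eq_vec_iff)
    ultimately have "0 \<le> t * t * F (a + \<delta> *\<^sub>R 1) + 2 * (t * F a) - 2 * (t * F (a + \<delta> *\<^sub>R 1))
        - F (a + \<delta> *\<^sub>R 1) + F (a + (\<delta> * 2) *\<^sub>R 1)"
      by (simp add: numeral_3_eq_3 h_def algebra_simps)
    moreover have "F (a + \<delta> *\<^sub>R 1) = g (Suc n)" "F (a + (\<delta> * 2) *\<^sub>R 1) = g n"
      using \<delta>(2) by (simp_all add: g_def \<delta>_def)
    ultimately show ?thesis by (simp add: power2_eq_square algebra_simps)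
  qed
  have lim: "0 \<le> t\<^sup>2 * L - 2 * t * (L - F a)" for t
  proof -
    have "(\<lambda>n. t\<^sup>2 * g (Suc n) - 2 * t * (g (Suc n) - F a) + (g n - g (Suc n)))
        \<longlonglongrightarrow> t\<^sup>2 * L - 2 * t * (L - F a) + (L - L)"
      by (intro tendsto_intros L LIMSEQ_Suc)
    from LIMSEQ_le_const[OF this, of 0] key show ?thesis by auto
  qed
  have "L \<le> F a"
  proof (rule ccontr)
    assume n: "\<not> L \<le> F a"
    have "0 \<le> F a" by (rule preserver_nonneg[OF a])
    with n have "0 < L" by simp
    \<comment> \<open>the quadratic in \<open>t\<close> is negative at its minimiser\<close>
    have "((L - F a) / L)\<^sup>2 * L - 2 * ((L - F a) / L) * (L - F a) = - ((L - F a)\<^sup>2 / L)"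
      using \<open>0 < L\<close> by (simp add: field_simps power2_eq_square)
    moreover have "0 < (L - F a)\<^sup>2 / L" using n \<open>0 < L\<close> by simp
    ultimately show False using lim[of "(L - F a) / L"] by simp
  qed
  hence "L < F a + e" using \<open>0 < e\<close> by simp
  then obtain n where "g n < F a + e"
    using order_tendstoD(2)[OF L(1)] by (auto simp: eventually_sequentially)
  thus ?thesis using \<delta>0 inside[OF _ le\<delta>0, of n]
    by (intro exI[of _ "\<delta>0 / 2 ^ n"]) (auto simp: g_def)
qed

text \<open>
  By \<open>preserver_geometric\<close>, a jump from below would have to be matched by a jump
  from above, which is excluded. Approaching \<open>a\<close> along its ray keeps zero
  coordinates at zero, so that boundary points need no separate treatment.
\<close>
lemma preserver_left_continuous:
  assumes a: "a \<in> cube (dom_I \<rho>)" and "0 < e"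
  shows "\<exists>t>1. F a - e < F ((1 / t) *\<^sub>R a)"
proof -
  obtain \<delta> where \<delta>: "0 < \<delta>" "a + \<delta> *\<^sub>R 1 \<in> cube (dom_I \<rho>)" "F (a + \<delta> *\<^sub>R 1) < F a + e"
    using preserver_right_continuous[OF assms] by blast
  \<comment> \<open>chosen so that \<open>t a \<le> a + \<delta> 1\<close>\<close>
  define t where "t = 1 + \<delta> / (1 + norm a)"
  have na: "0 < 1 + norm a" by (simp add: add_pos_nonneg)
  have t: "1 < t" using \<delta> na by (simp add: t_def)
  have a0: "0 \<le> vec_nth a k" for k using a by (simp add: mem_cube_dom_I)
  have ta: "t *\<^sub>R a \<le> a + \<delta> *\<^sub>R 1"
    unfolding le_vec_iff
  proof
    fix k
    have "vec_nth a k \<le> 1 + norm a" using component_le_norm_cart[of a k] by linarith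
    hence "\<delta> * vec_nth a k \<le> \<delta> * (1 + norm a)" using \<delta> by (intro mult_left_mono) auto
    hence "\<delta> / (1 + norm a) * vec_nth a k \<le> \<delta>" using na by (simp add: field_simps)
    thus "vec_nth (t *\<^sub>R a) k \<le> vec_nth (a + \<delta> *\<^sub>R 1) k" by (simp add: t_def algebra_simps)
  qed
  have ta0: "0 \<le> t *\<^sub>R a" using a0 t by (simp add: le_vec_iff)
  have tc: "t *\<^sub>R a \<in> cube (dom_I \<rho>)" by (rule cube_dom_I_interval[OF \<delta>(2) ta0 ta])
  have up: "F (t *\<^sub>R a) < F a + e" using preserver_mono[OF ta0 ta \<delta>(2)] \<delta>(3) by simp
  have "(1 / t) *\<^sub>R a \<in> cube (dom_I \<rho>)"
  proof (rule cube_dom_I_interval[OF a])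
    have a': "0 \<le> a" using a0 by (simp add: le_vec_iff)
    show "0 \<le> (1 / t) *\<^sub>R a" using a' t by (intro scaleR_nonneg_nonneg) auto
    have "(1 / t) *\<^sub>R a \<le> 1 *\<^sub>R a" using a' t by (intro scaleR_right_mono) auto
    thus "(1 / t) *\<^sub>R a \<le> a" by simp
  qed
  hence p0: "0 \<le> F ((1 / t) *\<^sub>R a)" by (rule preserver_nonneg)
  have f0: "0 \<le> F a" by (rule preserver_nonneg[OF a])
  have "F a - e < F ((1 / t) *\<^sub>R a)"
  proof (rule ccontr)
    assume n: "\<not> F a - e < F ((1 / t) *\<^sub>R a)"
    have "(F a)\<^sup>2 \<le> F ((1 / t) *\<^sub>R a) * F (t *\<^sub>R a)"
      by (rule preserver_geometric) (use t tc in auto)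
    also have "\<dots> \<le> F ((1 / t) *\<^sub>R a) * (F a + e)" using up p0 by (intro mult_left_mono) auto
    also have "\<dots> \<le> (F a - e) * (F a + e)" using n f0 \<open>0 < e\<close> by (intro mult_right_mono) auto
    also have "\<dots> = (F a)\<^sup>2 - e\<^sup>2" by (simp add: power2_eq_square algebra_simps)
    finally show False using \<open>0 < e\<close> by simp
  qed
  thus ?thesis using t by blast
qed

text \<open>
  By monotonicity, \<open>F x\<close> lies between the values at \<open>a / t\<close> and
  \<open>a + \<delta> 1\<close> for all \<open>x\<close> in the cube close to \<open>a\<close>.
\<close>
lemma preserver_continuous: "continuous_on (cube (dom_I \<rho>)) F"
  unfolding continuous_on_def
proof
  fix a :: "real ^ 'm" assume a: "a \<in> cube (dom_I \<rho>)"
  let ?net = "at a within cube (dom_I \<rho>)"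
  have a0: "0 \<le> vec_nth a k" for k using a by (simp add: mem_cube_dom_I)
  have lim: "((\<lambda>x. vec_nth x k) \<longlongrightarrow> vec_nth a k) ?net" for k by (intro tendsto_intros)
  have in_cube: "\<forall>\<^sub>F x in ?net. x \<in> cube (dom_I \<rho>)" by (simp add: eventually_at_filter)
  show "(F \<longlongrightarrow> F a) ?net"
  proof (rule order_tendstoI)
    fix l assume "l < F a"
    then obtain t where t: "1 < t" "l < F ((1 / t) *\<^sub>R a)"
      using preserver_left_continuous[OF a, of "F a - l"] by auto
    have "\<forall>\<^sub>F x in ?net. vec_nth a k / t \<le> vec_nth x k" for k
    proof (cases "vec_nth a k = 0")
      case True
      thus ?thesis using in_cube by (auto simp: mem_cube_dom_I elim: eventually_mono)
    next
      case False
      hence "vec_nth a k / t < vec_nth a k" using t a0[of k] by (simp add: field_simps)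
      from order_tendstoD(1)[OF lim this] show ?thesis by (auto elim: eventually_mono)
    qed
    hence "\<forall>\<^sub>F x in ?net. \<forall>k. vec_nth a k / t \<le> vec_nth x k" by (rule eventually_all_finite)
    thus "\<forall>\<^sub>F x in ?net. l < F x" using in_cube
    proof eventually_elim
      case (elim x)
      have "F ((1 / t) *\<^sub>R a) \<le> F x"
        using elim a0 t by (intro preserver_mono) (auto simp: le_vec_iff)
      thus ?case using t by simp
    qed
  next
    fix u assume "F a < u"
    then obtain \<delta> where \<delta>: "0 < \<delta>" "a + \<delta> *\<^sub>R 1 \<in> cube (dom_I \<rho>)" "F (a + \<delta> *\<^sub>R 1) < u"
      using preserver_right_continuous[OF a, of "u - F a"] by auto
    have "\<forall>\<^sub>F x in ?net. vec_nth x k \<le> vec_nth a k + \<delta>" for k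
      using order_tendstoD(2)[OF lim, of k "vec_nth a k + \<delta>"] \<delta> by (auto elim: eventually_mono)
    hence "\<forall>\<^sub>F x in ?net. \<forall>k. vec_nth x k \<le> vec_nth a k + \<delta>" by (rule eventually_all_finite)
    thus "\<forall>\<^sub>F x in ?net. F x < u" using in_cube
    proof eventually_elim
      case (elim x)
      have "F x \<le> F (a + \<delta> *\<^sub>R 1)"
        using elim \<delta>(2) by (intro preserver_mono) (auto simp: le_vec_iff mem_cube_dom_I)
      thus ?case using \<delta> by simp
    qed
  qed
qed

lemma preserver_hankel_positive:
  assumes hi: "hi \<in> cube (dom_I \<rho>)"
  shows "hankel_positive F 0 hi"
  unfolding hankel_positive_def
proof (intro allI impI)
  fix us :: "(real ^ 'm) list" and qs and p :: "real poly" and y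
  assume len: "length qs = length us" and us: "\<forall>u\<in>set us. 0 \<le> u" and qs: "\<forall>q\<in>set qs. 1 \<le> q"
    and y: "0 \<le> y" "y + combination (map (\<lambda>q. q ^ (2 * degree p)) qs) us \<le> hi"
  define s where "s k n = vec_nth (y + combination (map (\<lambda>q. q ^ n) qs) us) k" for k n
  have "psd (Suc (degree p)) (\<lambda>i j. F (\<chi> k. s k (i + j)))"
  proof (rule psd_entrywise_of_hankel[OF pres])
    fix k
    have "psd N (\<lambda>i j. vec_nth (combination (map (\<lambda>q. q ^ (i + j)) qs) us) k)" for N
      using len us
    proof (induction qs us rule: list_induct2)
      case (Cons q qs u us)
      have "psd N (\<lambda>i j. vec_nth u k * (real q ^ i * real q ^ j) + vec_nth (combination (map (\<lambda>q. q ^ (i + j)) qs) us) k)"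
        using Cons by (intro psd_add psd_mult[OF psd_const psd_rank_one] psd_const) (auto simp: le_vec_iff)
      thus ?case by (simp add: power_add mult_ac)
    qed (simp add: psd_const)
    moreover have "0 \<le> vec_nth y k" using y by (simp add: le_vec_iff)
    ultimately show "psd (Suc (degree p)) (\<lambda>i j. s k (i + j))"
      unfolding s_def vector_add_component by (intro psd_add psd_const)
  next
    fix k n assume "n \<le> 2 * (Suc (degree p) - 1)"
    hence "combination (map (\<lambda>q. q ^ n) qs) us \<le> combination (map (\<lambda>q. q ^ (2 * degree p)) qs) us"
      by (intro combination_power_mono len us qs) simp
    hence "y + combination (map (\<lambda>q. q ^ n) qs) us \<le> hi" using y(2) by (meson add_left_mono order_trans)
    moreover have "0 \<le> y + combination (map (\<lambda>q. q ^ n) qs) us"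
      using y(1) len us by (intro add_nonneg_nonneg combination_nonneg) auto
    ultimately have "y + combination (map (\<lambda>q. q ^ n) qs) us \<in> cube (dom_I \<rho>)"
      by (rule cube_dom_I_interval[OF hi, rotated])
    thus "s k n \<in> dom_I \<rho>" by (simp add: s_def cube_def)
  qed simp
  moreover have "(\<chi> k. s k n) = y + combination (map (\<lambda>q. q ^ n) qs) us" for n
    by (simp add: s_def eq_vec_iff)
  ultimately show "0 \<le> hankel_form p (\<lambda>n. F (y + combination (map (\<lambda>q. q ^ n) qs) us))"
    unfolding hankel_form_def psd_def lessThan_Suc_atMost by simp
qed

lemma preserver_mixed_diff_nonneg:
  assumes vs: "\<forall>v\<in>set vs. 0 \<le> v" and x: "x \<in> cube (dom_I \<rho>)" and xS: "x + sum_list vs \<in> cube (dom_I \<rho>)"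
  shows "0 \<le> mixed_diff vs F x"
proof -
  have S: "0 \<le> sum_list vs" using vs by (intro sum_list_nonneg) auto
  obtain \<eta> where \<eta>: "0 < \<eta>" "x + sum_list vs + \<eta> *\<^sub>R sum_list vs \<in> cube (dom_I \<rho>)"
    using cube_dom_I_room[OF xS S] by blast
  define hi where "hi = x + (1 + \<eta>) *\<^sub>R sum_list vs"
  have hi: "hi \<in> cube (dom_I \<rho>)" using \<eta>(2) by (simp add: hi_def algebra_simps)
  have "{0..hi} \<subseteq> cube (dom_I \<rho>)" using cube_dom_I_interval[OF hi] by auto
  hence "continuous_on {0..hi} F" using continuous_on_subset preserver_continuous by blast
  moreover have "0 \<le> x" using x by (simp add: mem_cube_dom_I le_vec_iff)
  ultimately show ?thesis
    using \<eta>(1) vs by (intro mixed_diff_nonneg_of_hankel_positive[OF preserver_hankel_positive[OF hi]])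
      (auto simp: hi_def)
qed

end

section \<open>Mixed differences and iterated partial derivatives\<close>

definition open_cube :: "ereal \<Rightarrow> (real ^ 'm) set" where
  "open_cube \<rho> = {x. \<forall>k. 0 < vec_nth x k \<and> ereal (vec_nth x k) < \<rho>}"

lemma open_open_cube: "open (open_cube \<rho> :: (real ^ 'm) set)"
proof -
  have eq: "open_cube \<rho> = (\<Inter>k. {x :: real ^ 'm. 0 < vec_nth x k} \<inter> {x. ereal (vec_nth x k) < \<rho>})"
    by (auto simp: open_cube_def)
  have "open {x :: real ^ 'm. 0 < vec_nth x k}" for k
    by (intro open_Collect_less continuous_intros)
  moreover have "open {x :: real ^ 'm. ereal (vec_nth x k) < \<rho>}" for k
    by (intro open_Collect_less continuous_on_ereal continuous_intros)
  ultimately show ?thesis unfolding eq by (intro open_INT ballI open_Int) simp_all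
qed

lemma interior_cube_dom_I: "interior (cube (dom_I \<rho>)) = (open_cube \<rho> :: (real ^ 'm) set)"
proof
  show "open_cube \<rho> \<subseteq> interior (cube (dom_I \<rho>) :: (real ^ 'm) set)"
    by (rule interior_maximal[OF _ open_open_cube]) (auto simp: open_cube_def mem_cube_dom_I less_imp_le)
  show "interior (cube (dom_I \<rho>)) \<subseteq> (open_cube \<rho> :: (real ^ 'm) set)"
  proof
    fix x :: "real ^ 'm" assume x: "x \<in> interior (cube (dom_I \<rho>))"
    then obtain e where e: "0 < e" "ball x e \<subseteq> cube (dom_I \<rho>)" by (auto simp: mem_interior)
    have "0 < vec_nth x k" for k
    proof -
      have "x - (e / 2) *\<^sub>R axis k 1 \<in> ball x e" using e by (simp add: dist_norm norm_axis_1)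
      hence "x - (e / 2) *\<^sub>R axis k 1 \<in> cube (dom_I \<rho>)" using e by blast
      hence "0 \<le> vec_nth (x - (e / 2) *\<^sub>R axis k 1) k" by (simp only: mem_cube_dom_I)
      thus ?thesis using e by (simp add: axis_def)
    qed
    moreover have "x \<in> cube (dom_I \<rho>)" using x interior_subset by blast
    ultimately show "x \<in> open_cube \<rho>" by (simp add: open_cube_def mem_cube_dom_I)
  qed
qed

definition order_interval_closed :: "'a::order set \<Rightarrow> bool" where
  "order_interval_closed S \<longleftrightarrow> (\<forall>x y z. x \<in> S \<longrightarrow> z \<in> S \<longrightarrow> x \<le> y \<longrightarrow> y \<le> z \<longrightarrow> y \<in> S)"

lemma order_interval_closed_cube: "order_interval_closed (cube (dom_I \<rho>) :: (real ^ 'm) set)"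
  unfolding order_interval_closed_def
proof (intro allI impI)
  fix x y z :: "real ^ 'm"
  assume *: "x \<in> cube (dom_I \<rho>)" "z \<in> cube (dom_I \<rho>)" "x \<le> y" "y \<le> z"
  have "0 \<le> x" using * by (simp add: mem_cube_dom_I le_vec_iff)
  hence "0 \<le> y" using *(3) by (rule order_trans)
  thus "y \<in> cube (dom_I \<rho>)" using *(4) by (rule cube_dom_I_interval[OF *(2)])
qed

lemma order_interval_closed_open_cube: "order_interval_closed (open_cube \<rho> :: (real ^ 'm) set)"
  unfolding order_interval_closed_def
proof (intro allI impI)
  fix x y z :: "real ^ 'm"
  assume *: "x \<in> open_cube \<rho>" "z \<in> open_cube \<rho>" "x \<le> y" "y \<le> z"
  have "z \<in> cube (dom_I \<rho>)" "x \<in> cube (dom_I \<rho>)" using *(1,2) by (auto simp: open_cube_def mem_cube_dom_I less_imp_le)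
  hence "y \<in> cube (dom_I \<rho>)" using *(3,4) order_interval_closed_cube unfolding order_interval_closed_def by blast
  moreover have "0 < vec_nth y k" for k
  proof -
    have "0 < vec_nth x k" "vec_nth x k \<le> vec_nth y k" using *(1,3) by (auto simp: open_cube_def le_vec_iff)
    thus ?thesis by linarith
  qed
  ultimately show "y \<in> open_cube \<rho>" by (simp add: open_cube_def mem_cube_dom_I)
qed

text \<open>
  A mixed difference only involves points between \<open>x\<close> and \<open>x + sum_list
  vs\<close>, so inductions over the list of steps never leave \<open>S\<close>.
\<close>
lemma mixed_diff_corner:
  fixes S :: "'a::ordered_ab_group_add set"
  assumes S: "order_interval_closed S" and v: "0 \<le> v" and vs: "\<forall>w\<in>set vs. 0 \<le> w"
    and x: "x \<in> S" "x + sum_list (v # vs) \<in> S"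
  shows "x + v \<in> S" "x + v + sum_list vs \<in> S" "x + sum_list vs \<in> S"
proof -
  have s: "0 \<le> sum_list vs" using vs by (intro sum_list_nonneg) auto
  show "x + v + sum_list vs \<in> S" using x by (simp add: add.assoc)
  have "x \<le> x + v" "x + v \<le> x + sum_list (v # vs)"
    "x \<le> x + sum_list vs" "x + sum_list vs \<le> x + sum_list (v # vs)"
    using v s by simp_all
  thus "x + v \<in> S" "x + sum_list vs \<in> S" using S x unfolding order_interval_closed_def by blast+
qed

lemma tendsto_mixed_diff:
  fixes S :: "'a::ordered_ab_group_add set"
  assumes S: "order_interval_closed S" and lim: "\<And>y. y \<in> S \<Longrightarrow> ((\<lambda>n. G n y) \<longlongrightarrow> g y) net"
    and "\<forall>v\<in>set vs. 0 \<le> v" "x \<in> S" "x + sum_list vs \<in> S"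
  shows "((\<lambda>n. mixed_diff vs (G n) x) \<longlongrightarrow> mixed_diff vs g x) net"
  using assms(3-5)
proof (induction vs arbitrary: x)
  case (Cons v vs)
  note corner = mixed_diff_corner[OF S, of v vs x]
  show ?case
    using Cons corner by (auto simp: fwd_diff_def intro!: tendsto_diff)
qed (use lim in simp)

lemma has_field_derivative_mixed_diff:
  fixes S :: "'a::{ordered_ab_group_add, real_vector} set"
  assumes S: "order_interval_closed S"
    and der: "\<And>y. y \<in> S \<Longrightarrow> ((\<lambda>t. G (y + t *\<^sub>R e)) has_field_derivative g y) (at 0)"
    and "\<forall>v\<in>set vs. 0 \<le> v" "x \<in> S" "x + sum_list vs \<in> S"
  shows "((\<lambda>t. mixed_diff vs G (x + t *\<^sub>R e)) has_field_derivative mixed_diff vs g x) (at 0)"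
  using assms(3-5)
proof (induction vs arbitrary: x)
  case (Cons v vs)
  note corner = mixed_diff_corner[OF S, of v vs x]
  have "((\<lambda>t. mixed_diff vs G (x + v + t *\<^sub>R e) - mixed_diff vs G (x + t *\<^sub>R e)) has_field_derivative
      mixed_diff vs g (x + v) - mixed_diff vs g x) (at 0)"
    using Cons corner by (intro DERIV_diff) auto
  thus ?case by (simp add: fwd_diff_def add_ac)
qed (use der in simp)

lemma axis_step_nonneg: "axis_step v \<Longrightarrow> 0 \<le> v"
  by (auto simp: axis_step_def le_vec_iff axis_def)

lemma axis_step_axis: "0 \<le> t \<Longrightarrow> axis_step (t *\<^sub>R axis k 1)"
  by (auto simp: axis_step_def)

text \<open>
  Along a line, \<open>G\<close> has non-negative differences of all orders, hence is
  differentiable. A mixed difference of the quotient \<open>(G(x + h e) - G x) / h\<close> is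
  \<open>1 / h\<close> times one of \<open>G\<close> with one more step, and its sign survives
  the limit \<open>h \<rightarrow> 0\<close>. The derivative thus satisfies the hypothesis made
  on \<open>G\<close>, and the step can be iterated.
\<close>
lemma differences_nonneg_partial:
  fixes G :: "real ^ 'm \<Rightarrow> real" and k :: 'm
  assumes diffs: "differences_nonneg_on (open_cube \<rho>) G"
  defines "g \<equiv> \<lambda>x. deriv (\<lambda>t. G (x + t *\<^sub>R axis k 1)) 0"
  shows "\<And>x. x \<in> open_cube \<rho> \<Longrightarrow> (\<lambda>t. G (x + t *\<^sub>R axis k 1)) field_differentiable (at 0)"
    and "differences_nonneg_on (open_cube \<rho>) g"
proof -
  let ?e = "axis k 1 :: real ^ 'm"
  have pos: "0 \<le> mixed_diff vs G x" if "\<forall>v\<in>set vs. axis_step v" "x \<in> open_cube \<rho>" "x + sum_list vs \<in> open_cube \<rho>" for vs x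
    using diffs that unfolding differences_nonneg_on_def by blast
  have near: "\<exists>\<epsilon>>0. \<forall>t. \<bar>t\<bar> < \<epsilon> \<longrightarrow> x + t *\<^sub>R ?e \<in> open_cube \<rho>" if x: "x \<in> open_cube \<rho>" for x
  proof -
    obtain \<epsilon> where "0 < \<epsilon>" "ball x \<epsilon> \<subseteq> open_cube \<rho>" using open_open_cube x by (meson open_contains_ball)
    thus ?thesis by (intro exI[of _ \<epsilon>]) (auto simp: subset_iff dist_norm norm_axis_1)
  qed
  show diff: "(\<lambda>t. G (x + t *\<^sub>R ?e)) field_differentiable (at 0)" if x: "x \<in> open_cube \<rho>" for x
  proof -
    obtain \<epsilon> where \<epsilon>: "0 < \<epsilon>" "\<And>t. \<bar>t\<bar> < \<epsilon> \<Longrightarrow> x + t *\<^sub>R ?e \<in> open_cube \<rho>" using near[OF x] by blast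
    let ?f = "\<lambda>t. G (x + t *\<^sub>R ?e)"
    show ?thesis
    proof (rule differentiable_of_differences[of "- \<epsilon>" \<epsilon>])
      fix n :: nat and t h :: real assume t: "- \<epsilon> < t" "0 \<le> h" "t + real n * h < \<epsilon>"
      have "0 \<le> mixed_diff (replicate n (h *\<^sub>R ?e)) G (x + t *\<^sub>R ?e)"
      proof (rule pos)
        have "0 \<le> real n * h" using t by simp
        hence "\<bar>t\<bar> < \<epsilon>" "\<bar>t + real n * h\<bar> < \<epsilon>" using t by linarith+
        moreover have "sum_list (replicate n (h *\<^sub>R ?e)) = (real n * h) *\<^sub>R ?e"
          by (induction n) (simp_all add: algebra_simps)
        ultimately show "x + t *\<^sub>R ?e \<in> open_cube \<rho>" "x + t *\<^sub>R ?e + sum_list (replicate n (h *\<^sub>R ?e)) \<in> open_cube \<rho>"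
          using \<epsilon>(2)[of t] \<epsilon>(2)[of "t + real n * h"] by (simp_all add: algebra_simps)
      qed (use t axis_step_axis in auto)
      thus "0 \<le> (fwd_diff h ^^ n) ?f t" by (simp only: funpow_fwd_diff_line mixed_diff_replicate)
    qed (use \<epsilon> in auto)
  qed
  show "differences_nonneg_on (open_cube \<rho>) g"
    unfolding differences_nonneg_on_def
  proof (intro allI impI)
    fix vs :: "(real ^ 'm) list" and x
    assume vs: "\<forall>v\<in>set vs. axis_step v" and x: "x \<in> open_cube \<rho>" and xS: "x + sum_list vs \<in> open_cube \<rho>"
    have "((\<lambda>h. (G (y + h *\<^sub>R ?e) - G y) / h) \<longlongrightarrow> g y) (at_right 0)" if "y \<in> open_cube \<rho>" for y
    proof -
      have "((\<lambda>t. G (y + t *\<^sub>R ?e)) has_field_derivative g y) (at 0)"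
        using diff[OF that] unfolding g_def by (simp add: field_differentiable_derivI)
      hence "((\<lambda>h. (G (y + h *\<^sub>R ?e) - G y) / h) \<longlongrightarrow> g y) (at 0)" by (simp add: DERIV_def)
      thus ?thesis by (rule tendsto_mono[rotated]) (simp add: at_le)
    qed
    hence lim: "((\<lambda>h. mixed_diff vs (\<lambda>y. (G (y + h *\<^sub>R ?e) - G y) / h) x) \<longlongrightarrow> mixed_diff vs g x) (at_right 0)"
      using vs x xS axis_step_nonneg by (intro tendsto_mixed_diff[OF order_interval_closed_open_cube]) auto
    have scale: "mixed_diff vs (\<lambda>y. f y / h) y = mixed_diff vs f y / h" for f :: "real ^ 'm \<Rightarrow> real" and h y
      by (induction vs arbitrary: y) (simp_all add: fwd_diff_def diff_divide_distrib)
    obtain \<epsilon> where \<epsilon>: "0 < \<epsilon>" "\<And>t. \<bar>t\<bar> < \<epsilon> \<Longrightarrow> x + sum_list vs + t *\<^sub>R ?e \<in> open_cube \<rho>" using near[OF xS] by blast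
    have "0 \<le> mixed_diff vs (\<lambda>y. (G (y + h *\<^sub>R ?e) - G y) / h) x" if h: "0 < h" "h < \<epsilon>" for h
    proof -
      have "mixed_diff vs (\<lambda>y. (G (y + h *\<^sub>R ?e) - G y) / h) x = mixed_diff vs (fwd_diff (h *\<^sub>R ?e) G) x / h"
        unfolding scale fwd_diff_def ..
      also have "mixed_diff vs (fwd_diff (h *\<^sub>R ?e) G) x = mixed_diff (h *\<^sub>R ?e # vs) G x"
        by (simp add: mixed_diff_fwd_diff)
      also have "\<dots> / h \<ge> 0"
        using h vs x \<epsilon>(2)[of h] axis_step_axis[of h k] by (intro divide_nonneg_pos pos) (auto simp: add_ac)
      finally show ?thesis .
    qed
    hence "\<forall>\<^sub>F h in at_right 0. 0 \<le> mixed_diff vs (\<lambda>y. (G (y + h *\<^sub>R ?e) - G y) / h) x"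
      using \<epsilon>(1) by (auto simp: eventually_at_right_field)
    with lim show "0 \<le> mixed_diff vs g x" by (intro tendsto_lowerbound[OF lim]) auto
  qed
qed

lemma iter_partial_of_differences_nonneg:
  fixes F :: "real ^ 'm \<Rightarrow> real"
  assumes "differences_nonneg_on (open_cube \<rho>) F"
  shows "(\<forall>x\<in>open_cube \<rho>. iter_partial_exists ks F x) \<and> differences_nonneg_on (open_cube \<rho>) (iter_partial ks F)"
proof (induction ks)
  case (Cons k ks)
  have ex: "iter_partial_exists ks F x" if "x \<in> open_cube \<rho>" for x
    using Cons that by blast
  have diffs: "differences_nonneg_on (open_cube \<rho>) (iter_partial ks F)"
    using Cons by blast
  have "iter_partial_exists (k # ks) F x" if x: "x \<in> open_cube \<rho>" for x
    unfolding iter_partial_exists.simps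
  proof
    show "\<forall>\<^sub>F y in nhds x. iter_partial_exists ks F y"
      by (rule eventually_mono[OF eventually_nhds_in_open[OF open_open_cube x] ex])
    show "(\<lambda>t. iter_partial ks F (x + t *\<^sub>R axis k 1)) field_differentiable (at 0)"
      by (rule differences_nonneg_partial(1)[OF diffs x])
  qed
  moreover have "differences_nonneg_on (open_cube \<rho>) (iter_partial (k # ks) F)"
    unfolding iter_partial.simps by (rule differences_nonneg_partial(2)[OF diffs])
  ultimately show ?case by blast
next
  case Nil
  show ?case unfolding iter_partial.simps iter_partial_exists.simps using assms by blast
qed

lemma absolutely_monotonic_of_differences_nonneg:
  fixes F :: "real ^ 'm \<Rightarrow> real"
  assumes "continuous_on (cube (dom_I \<rho>)) F" "differences_nonneg_on (cube (dom_I \<rho>)) F"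
  shows "absolutely_monotonic_on (cube (dom_I \<rho>)) F"
proof -
  have "open_cube \<rho> \<subseteq> (cube (dom_I \<rho>) :: (real ^ 'm) set)"
    unfolding interior_cube_dom_I[symmetric] by (rule interior_subset)
  hence "differences_nonneg_on (open_cube \<rho>) F"
    using assms(2) unfolding differences_nonneg_on_def by blast
  note partials = iter_partial_of_differences_nonneg[OF this]
  have "iter_partial_exists ks F x \<and> 0 \<le> iter_partial ks F x" if x: "x \<in> open_cube \<rho>" for ks x
  proof
    show "iter_partial_exists ks F x" using partials x by blast
    have "differences_nonneg_on (open_cube \<rho>) (iter_partial ks F)" using partials by blast
    from this[unfolded differences_nonneg_on_def, rule_format, of "[]" x] x
    show "0 \<le> iter_partial ks F x" by simp
  qed
  thus ?thesis using assms(1) unfolding absolutely_monotonic_on_def interior_cube_dom_I by blast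
qed

text \<open>
  In the interior, one step at a time: as a function of the length of the step, the mixed
  difference along the remaining steps has as derivative a mixed difference of one more partial
  derivative, which is non-negative by the induction hypothesis. Points on the boundary are
  reached by pushing the whole configuration inwards along \<open>(1, \<dots>, 1)\<close>.
\<close>
lemma differences_nonneg_of_absolutely_monotonic:
  fixes F :: "real ^ 'm \<Rightarrow> real"
  assumes am: "absolutely_monotonic_on (cube (dom_I \<rho>)) F"
  shows "differences_nonneg_on (cube (dom_I \<rho>)) F"
proof -
  have cont: "continuous_on (cube (dom_I \<rho>)) F" using am by (simp add: absolutely_monotonic_on_def)
  have "ks \<in> orders (count_list ks)" for ks :: "'m list" by (simp add: orders_def)
  hence am': "iter_partial_exists ks F x \<and> 0 \<le> iter_partial ks F x" if "x \<in> open_cube \<rho>" for ks x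
    using am that unfolding absolutely_monotonic_on_def interior_cube_dom_I by blast
  have inner: "0 \<le> mixed_diff vs (iter_partial ks F) x"
    if "\<forall>v\<in>set vs. axis_step v" "x \<in> open_cube \<rho>" "x + sum_list vs \<in> open_cube \<rho>" for vs ks x
    using that
  proof (induction vs arbitrary: ks x)
    case Nil
    thus ?case using am' by simp
  next
    case (Cons v vs)
    then obtain k t where t: "0 \<le> t" "v = t *\<^sub>R axis k 1" by (auto simp: axis_step_def)
    let ?e = "axis k 1 :: real ^ 'm" and ?G = "iter_partial ks F" and ?g = "iter_partial (k # ks) F"
    have e0: "0 \<le> ?e" using axis_step_nonneg[OF axis_step_axis[of 1 k]] by simp
    have vs0: "\<forall>w\<in>set vs. 0 \<le> w" and s0: "0 \<le> sum_list vs"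
      using Cons.prems axis_step_nonneg by (auto intro!: sum_list_nonneg)
    have der: "((\<lambda>s. ?G (y + s *\<^sub>R ?e)) has_field_derivative ?g y) (at 0)" if "y \<in> open_cube \<rho>" for y
      using am'[OF that, of "k # ks"] by (simp add: field_differentiable_derivI)
    \<comment> \<open>mean value theorem in the length \<open>s\<close> of the step along \<open>v\<close>\<close>
    have "mixed_diff vs ?G (x + 0 *\<^sub>R ?e) \<le> mixed_diff vs ?G (x + t *\<^sub>R ?e)"
    proof (rule DERIV_nonneg_imp_nondecreasing[OF t(1)])
      fix s assume s: "0 \<le> s" "s \<le> t"
      have "0 \<le> s *\<^sub>R ?e" "s *\<^sub>R ?e \<le> v"
        using s e0 t by (auto intro: scaleR_nonneg_nonneg scaleR_right_mono)
      hence "x \<le> x + s *\<^sub>R ?e" "x + s *\<^sub>R ?e \<le> x + sum_list (v # vs)"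
        "x \<le> x + s *\<^sub>R ?e + sum_list vs" "x + s *\<^sub>R ?e + sum_list vs \<le> x + sum_list (v # vs)"
        using s0 by (auto simp: add.assoc intro: add_increasing2 add_mono)
      hence y: "x + s *\<^sub>R ?e \<in> open_cube \<rho>" "x + s *\<^sub>R ?e + sum_list vs \<in> open_cube \<rho>"
        using order_interval_closed_open_cube Cons.prems(2,3) unfolding order_interval_closed_def by blast+
      have "((\<lambda>r. mixed_diff vs ?G (x + s *\<^sub>R ?e + r *\<^sub>R ?e)) has_field_derivative mixed_diff vs ?g (x + s *\<^sub>R ?e)) (at 0)"
        by (rule has_field_derivative_mixed_diff[OF order_interval_closed_open_cube der vs0 y])
      hence "((\<lambda>r. mixed_diff vs ?G (x + (r + s) *\<^sub>R ?e)) has_field_derivative mixed_diff vs ?g (x + s *\<^sub>R ?e)) (at 0)"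
        by (simp add: algebra_simps)
      hence "((\<lambda>r. mixed_diff vs ?G (x + r *\<^sub>R ?e)) has_field_derivative mixed_diff vs ?g (x + s *\<^sub>R ?e)) (at s)"
        using DERIV_shift[of "\<lambda>r. mixed_diff vs ?G (x + r *\<^sub>R ?e)" _ 0 s] by simp
      moreover have "0 \<le> mixed_diff vs ?g (x + s *\<^sub>R ?e)"
        using Cons.prems y by (intro Cons.IH) auto
      ultimately show "\<exists>D. ((\<lambda>r. mixed_diff vs ?G (x + r *\<^sub>R ?e)) has_real_derivative D) (at s) \<and> 0 \<le> D" by blast
    qed
    thus ?case by (simp add: fwd_diff_def t(2))
  qed
  show ?thesis
    unfolding differences_nonneg_on_def
  proof (intro allI impI)
    fix vs :: "(real ^ 'm) list" and x
    assume vs: "\<forall>v\<in>set vs. axis_step v" and x: "x \<in> cube (dom_I \<rho>)" and xS: "x + sum_list vs \<in> cube (dom_I \<rho>)"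
    have one: "(0 :: real ^ 'm) \<le> 1" by (simp add: le_vec_iff)
    have push: "\<exists>d>0. \<forall>\<delta>. 0 < \<delta> \<and> \<delta> < d \<longrightarrow> y + \<delta> *\<^sub>R 1 \<in> open_cube \<rho>" if y: "y \<in> cube (dom_I \<rho>)" for y :: "real ^ 'm"
    proof -
      obtain d where d: "0 < d" "y + d *\<^sub>R 1 \<in> cube (dom_I \<rho>)" using cube_dom_I_room[OF y one] by blast
      have "y + \<delta> *\<^sub>R 1 \<in> open_cube \<rho>" if "0 < \<delta>" "\<delta> < d" for \<delta>
      proof -
        have "y + \<delta> *\<^sub>R 1 \<in> cube (dom_I \<rho>)"
          by (rule cube_dom_I_interval[OF d(2)]) (use that y in \<open>auto simp: le_vec_iff mem_cube_dom_I\<close>)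
        moreover have "0 < vec_nth (y + \<delta> *\<^sub>R 1) i" for i using that y by (simp add: mem_cube_dom_I add_nonneg_pos)
        ultimately show ?thesis by (simp add: open_cube_def mem_cube_dom_I)
      qed
      thus ?thesis using d by blast
    qed
    have "((\<lambda>\<delta>. F (y + \<delta> *\<^sub>R 1)) \<longlongrightarrow> F y) (at_right 0)" if y: "y \<in> cube (dom_I \<rho>)" for y
    proof (rule continuous_on_tendsto_compose[OF cont _ y])
      show "((\<lambda>\<delta>. y + \<delta> *\<^sub>R 1) \<longlongrightarrow> y) (at_right 0)" by (rule tendsto_eq_intros refl | simp)+
      obtain d where "0 < d" "\<forall>\<delta>. 0 < \<delta> \<and> \<delta> < d \<longrightarrow> y + \<delta> *\<^sub>R 1 \<in> open_cube \<rho>" using push[OF y] by blast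
      moreover have "open_cube \<rho> \<subseteq> (cube (dom_I \<rho>) :: (real ^ 'm) set)"
        unfolding interior_cube_dom_I[symmetric] by (rule interior_subset)
      ultimately show "\<forall>\<^sub>F \<delta> in at_right 0. y + \<delta> *\<^sub>R 1 \<in> cube (dom_I \<rho>)"
        unfolding eventually_at_right_field by blast
    qed
    hence "((\<lambda>\<delta>. mixed_diff vs (\<lambda>y. F (y + \<delta> *\<^sub>R 1)) x) \<longlongrightarrow> mixed_diff vs F x) (at_right 0)"
      using vs x xS axis_step_nonneg by (intro tendsto_mixed_diff[OF order_interval_closed_cube]) auto
    moreover have "mixed_diff vs (\<lambda>y. F (y + s)) x = mixed_diff vs F (x + s)" for s
      by (induction vs arbitrary: x) (simp_all add: fwd_diff_def add_ac)
    ultimately have lim: "((\<lambda>\<delta>. mixed_diff vs F (x + \<delta> *\<^sub>R 1)) \<longlongrightarrow> mixed_diff vs F x) (at_right 0)" by simp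
    obtain d d' where d: "0 < d" "\<forall>\<delta>. 0 < \<delta> \<and> \<delta> < d \<longrightarrow> x + \<delta> *\<^sub>R 1 \<in> open_cube \<rho>"
      and d': "0 < d'" "\<forall>\<delta>. 0 < \<delta> \<and> \<delta> < d' \<longrightarrow> x + sum_list vs + \<delta> *\<^sub>R 1 \<in> open_cube \<rho>"
      using push[OF x] push[OF xS] by blast
    have "0 \<le> mixed_diff vs F (x + \<delta> *\<^sub>R 1)" if "0 < \<delta>" "\<delta> < min d d'" for \<delta>
      using inner[of vs "x + \<delta> *\<^sub>R 1" "[]"] vs d d' that by (simp add: add_ac)
    hence "\<forall>\<^sub>F \<delta> in at_right 0. 0 \<le> mixed_diff vs F (x + \<delta> *\<^sub>R 1)"
      unfolding eventually_at_right_field using d(1) d'(1) by (intro exI[of _ "min d d'"]) simp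
    thus "0 \<le> mixed_diff vs F x" by (rule tendsto_lowerbound[OF lim]) simp
  qed
qed

section \<open>The equivalence\<close>

theorem proposition9p8:
  fixes \<rho> :: ereal and F :: "real ^ 'm \<Rightarrow> real"
  assumes "0 < \<rho>"
  shows "(preserves_positivity F (positive_hankel_mats (dom_I \<rho>)) \<longleftrightarrow>
            absolutely_monotonic_on (cube (dom_I \<rho>)) F) \<and>
         (absolutely_monotonic_on (cube (dom_I \<rho>)) F \<longleftrightarrow>
            preserves_positivity F (positive_mats (dom_I \<rho>)))"
proof -
  have "absolutely_monotonic_on (cube (dom_I \<rho>)) F"
    if pres: "preserves_positivity F (positive_hankel_mats (dom_I \<rho>))"
  proof (rule absolutely_monotonic_of_differences_nonneg[OF preserver_continuous[OF pres]])
    show "differences_nonneg_on (cube (dom_I \<rho>)) F"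
      unfolding differences_nonneg_on_def
      using preserver_mixed_diff_nonneg[OF pres] axis_step_nonneg by blast
  qed
  moreover have "preserves_positivity F (positive_mats (dom_I \<rho>))"
    if am: "absolutely_monotonic_on (cube (dom_I \<rho>)) F"
    using preserves_positivity_of_differences_nonneg[OF assms _ differences_nonneg_of_absolutely_monotonic[OF am]] am
    by (simp add: absolutely_monotonic_on_def)
  moreover have "preserves_positivity F (positive_hankel_mats (dom_I \<rho>))"
    if "preserves_positivity F (positive_mats (dom_I \<rho>))"
    using that by (auto simp: preserves_positivity_def positive_hankel_mats_def)
  ultimately show ?thesis by blast
qed

end
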